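(* For each of the following simply connected, indecomposable classical symmetric spaces $M=G/K$ of compact type, with base point $eK$, and each of the following elements $\xi$, which are of extrinsically symmetric type, the spindle number $\lambda(M,\xi)$ is as stated. (A I) $M=SU(p+q)/SO(p+q)$, $1\le p\le q$, $\xi=i\begin{pmatrix} aI_p & 0 \\ 0 & bI_q \end{pmatrix}$ with $a=-\frac{q}{p+q}$, $b=\frac{p}{p+q}$: $\lambda(M,\xi)$ is the smallest positive integer $n$ such that $n\frac{p}{p+q}$ and $n\frac{q}{p+q}$ are integers; equivalently $\lambda(M,\xi)=\frac{p+q}{\gcd(p,q)}$. (A II) $M=SU(2(p+q))/Sp(p+q)$, $1\le p\le q$, $\xi=\begin{pmatrix} E & 0 \\ 0 & E \end{pmatrix}$ with $E=i\begin{pmatrix} aI_p & 0 \\ 0 & bI_q \end{pmatrix}$, $a=-\frac{q}{p+q}$, $b=\frac{p}{p+q}$: $\lambda(M,\xi)$ is the smallest positive integer $n$ such that $n\frac{p}{p+q}$ and $n\frac{q}{p+q}$ are integers; equivalently $\lambda(M,\xi)=\frac{p+q}{\gcd(p,q)}$. (A III) $M=SU(2n)/S(U(n)\times U(n))$, $n\ge1$, $\xi=\frac i2\begin{pmatrix} 0 & I_n \\ {I_n} & 0 \end{pmatrix}$: $\lambda(M,\xi)=2$. (BD I, first case) $M=SO(p+q)/(SO(p)\times SO(q))$, $1\le p\le q$, $p+q\ge3$, $(p,q)\neq(2,2)$, $\xi=\begin{pmatrix} 0 & E \\ -E^T & 0 \end{pmatrix}$, where $E$ is the $p\times q$ matrix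 whose $(1,1)$ entry is $1$ and whose other entries are $0$: $\lambda(M,\xi)=2$. (BD I, second case) $M=SO(2n)/(SO(n)\times SO(n))$, $n\ge3$, $\xi=\frac12J_n$: $\lambda(M,\xi)=2$ if $n$ is even and $\lambda(M,\xi)=4$ if $n$ is odd. (D III) $M=SO(4n)/U(2n)$, $n\ge1$, $\xi=\frac12\begin{pmatrix} J_n & 0 \\ 0 & -J_n \end{pmatrix}$: $\lambda(M,\xi)=2$. (C I) $M=Sp(n)/U(n)$, $n\ge1$, $\xi=\frac i2\begin{pmatrix} I_n & 0 \\ 0 & -I_n \end{pmatrix}$: $\lambda(M,\xi)=2$. (C II) $M=Sp(2n)/(Sp(n)\times Sp(n))$, $n\ge1$, $\xi=\frac i2\begin{pmatrix} 0 & 0 & 0 & I_n \\ 0 & 0 & I_n & 0 \\ 0 & I_n & 0 & 0 \\ {I_n} & 0 & 0 & 0 \end{pmatrix}$: $\lambda(M,\xi)=2$.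
   Context: Matrix conventions: $J_n=\begin{pmatrix} 0 & -I_n \\ {I_n} & 0 \end{pmatrix}$. $Sp(m)\subset SU(2m)$ is the group of unitary $2m\times2m$ matrices $U$ with $U^TJ_mU=J_m$, i.e. unitary matrices of the form $\begin{pmatrix} A & -\overline{B} \\ {B} & \overline{A} \end{pmatrix}$. In type D III, $U(2n)$ is the subgroup of matrices in $SO(4n)$ commuting with $J_{2n}$ (equivalently $SO(4n)\cap Sp(2n)$). In type C I, $U(n)=Sp(n)\cap SO(2n)$. In type C II, $Sp(n)\times Sp(n)\subset Sp(2n)$ is the subgroup commuting with $\mathrm{diag}(I_n,-I_n,I_n,-I_n)$. In types A III and BD I the subgroups are block diagonal. The listed groups need not act effectively. In each case $\xi$ lies in the $(-1)$-eigenspace $\mathfrak p$ of the Cartan involution, and $\mathfrak p\cong T_{eK}M$; the geodesic with initial vector $\xi$ is $t\mapsto\exp(t\xi)K$. General definitions: let $M$ be a connected Riemannian symmetric space of compact type, $p\in M$, $K_0$ the identity component of the isotropy group of $p$ in the isometry group, $\mathfrak g=\mathfrak k\oplus\mathfrak p$ the Cartan decomposition of the Lie algebra $\mathfrak g$ of the isometry group at $p$, $\mathfrak p\cong T_pM$, $\mathrm{Exp}_p$ the Riemannian exponential map and $\gamma_\xi(t)=\mathrm{Exp}_p(t\xi)$. Canonical element: a non-zero $\xi\in\mathfrak p$ such that $\gamma_\xi$ is a closed (periodic) geodesic and the eigenvalues of $\mathrm{ad}(\xi)$ on the complexification of $\mathfrak g$ are $i\nu$ with $\nu$ integers that are relatively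 prime. It is of extrinsically symmetric type if $\mathrm{ad}(\xi)^3=-\mathrm{ad}(\xi)$. Spindle number: for canonical $\xi$ let $M^\xi=\mathrm{Ad}(K_0)\xi\subset\mathfrak p$ and $M^\xi_t=\mathrm{Exp}_p(t\cdot M^\xi)$. A member $M^\xi_t$ that is a single point is a knot. Let $t_\xi>0$ be the period of $\gamma_\xi$ ($\gamma_\xi(t_\xi)=p$, $p\notin\gamma_\xi((0,t_\xi))$). Then $\lambda(M,\xi)$ is the number of $t\in[0,t_\xi)$ for which $M^\xi_t$ is a knot. *)

theory Defs
  imports "HOL-Analysis.Analysis"
begin

text \<open>All groups are represented by sets of complex matrices; the real groups are the subsets
  of matrices with real entries. Block matrices are indexed by sum types, so that for example
  a $2n \times 2n$ matrix has index type \<open>'n + 'n\<close>. Index types are nonempty, hence \<open>CARD('n) \<ge> 1\<close>.\<close>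

type_synonym 'm cmat = "complex^'m^'m"

definition block ::
  "'a^'p^'p \<Rightarrow> 'a^'q^'p \<Rightarrow> 'a^'p^'q \<Rightarrow> 'a^'q^'q \<Rightarrow> 'a^('p::finite + 'q::finite)^('p + 'q)" where
  "block A B C D = (\<chi> i j. case i of
      Inl r \<Rightarrow> (case j of Inl c \<Rightarrow> A $ r $ c | Inr c \<Rightarrow> B $ r $ c)
    | Inr r \<Rightarrow> (case j of Inl c \<Rightarrow> C $ r $ c | Inr c \<Rightarrow> D $ r $ c))"

definition cnj_mat :: "('m::finite) cmat \<Rightarrow> 'm cmat" where
  "cnj_mat A = (\<chi> i j. cnj (A $ i $ j))"

text \<open>The type \<open>complex^'m^'m\<close> is no instance of the class of normed algebras (its \<open>(*)\<close> is the
  entrywise product), so the library's \<open>exp\<close> does not apply to it.\<close>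

definition mexp :: "('m::finite) cmat \<Rightarrow> 'm cmat" where
  "mexp A = (\<Sum>k. (1 / fact k) *\<^sub>R (((**) A ^^ k) (mat 1)))"

definition bracket :: "('m::finite) cmat \<Rightarrow> 'm cmat \<Rightarrow> 'm cmat" where
  "bracket X Y = X ** Y - Y ** X"

definition lie_algebra :: "('m::finite) cmat set \<Rightarrow> 'm cmat set" where
  "lie_algebra G = {X. \<forall>t::real. mexp (t *\<^sub>R X) \<in> G}"


section \<open>The classical groups\<close>

definition J :: "('n::finite + 'n) cmat" where
  "J = block 0 (- mat 1) (mat 1) 0"

definition U :: "('m::finite) cmat set" where
  "U = {A. transpose (cnj_mat A) ** A = mat 1}"

definition SU :: "('m::finite) cmat set" where
  "SU = {A \<in> U. det A = 1}"

definition SO :: "('m::finite) cmat set" where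
  "SO = {A. (\<forall>i j. A $ i $ j \<in> \<real>) \<and> transpose A ** A = mat 1 \<and> det A = 1}"

definition Sp :: "('n::finite + 'n) cmat set" where
  "Sp = {A \<in> U. transpose A ** J ** A = J}"


section \<open>Symmetric spaces, canonical elements and the spindle number\<close>

text \<open>A symmetric space \<open>M = G/K\<close> with base point \<open>eK\<close> is given by a compact matrix group \<open>G\<close>,
  the subgroup \<open>K\<close> and the Cartan involution. The involutions used below are
  real linear maps on the space of all matrices, so the same map serves as the involution
  of \<open>G\<close> and as its differential on the Lie algebra.\<close>

record 'a sym_space =
  grp :: "'a set"
  isot :: "'a set"
  invol :: "'a \<Rightarrow> 'a"

definition lie_p :: "('m::finite) cmat sym_space \<Rightarrow> 'm cmat set" where
  "lie_p S = {X \<in> lie_algebra (grp S). invol S X = - X}"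

text \<open>The points of \<open>M\<close> are the left cosets of \<open>K\<close>.\<close>

definition point :: "('m::finite) cmat sym_space \<Rightarrow> 'm cmat \<Rightarrow> 'm cmat set" where
  "point S g = {g ** k | k. k \<in> isot S}"

definition Exp :: "('m::finite) cmat sym_space \<Rightarrow> 'm cmat \<Rightarrow> 'm cmat set" where
  "Exp S X = point S (mexp X)"

definition geodesic :: "('m::finite) cmat sym_space \<Rightarrow> 'm cmat \<Rightarrow> real \<Rightarrow> 'm cmat set" where
  "geodesic S \<xi> t = Exp S (t *\<^sub>R \<xi>)"

definition closed_geodesic :: "('m::finite) cmat sym_space \<Rightarrow> 'm cmat \<Rightarrow> bool" where
  "closed_geodesic S \<xi> \<longleftrightarrow> (\<exists>T>0. \<forall>t. geodesic S \<xi> (t + T) = geodesic S \<xi> t)"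

text \<open>Eigenvalues of \<open>ad \<xi>\<close> on the complexification of the real Lie algebra \<open>\<gg>\<close>. The pair \<open>(X, Y)\<close>
  stands for the element \<open>X + iY\<close> of the complexification; this formal \<open>i\<close> is not the scalar
  \<open>\<i>\<close> acting on complex matrices.\<close>

definition ad_eigenvalues :: "('m::finite) cmat set \<Rightarrow> 'm cmat \<Rightarrow> complex set" where
  "ad_eigenvalues \<gg> \<xi> = {\<mu>. \<exists>X\<in>\<gg>. \<exists>Y\<in>\<gg>. (X, Y) \<noteq> (0, 0) \<and>
      bracket \<xi> X = Re \<mu> *\<^sub>R X - Im \<mu> *\<^sub>R Y \<and>
      bracket \<xi> Y = Im \<mu> *\<^sub>R X + Re \<mu> *\<^sub>R Y}"

text \<open>We use the Lie algebra of \<open>G\<close> in place of that of the isometry group. The action of \<open>G\<close> on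
  \<open>M\<close> need not be effective, but the ideal acting trivially on \<open>M\<close> commutes with \<open>\<pp>\<close>, so it
  contributes at most the eigenvalue \<open>0\<close>.\<close>

definition canonical :: "('m::finite) cmat sym_space \<Rightarrow> 'm cmat \<Rightarrow> bool" where
  "canonical S \<xi> \<longleftrightarrow> \<xi> \<in> lie_p S \<and> \<xi> \<noteq> 0 \<and> closed_geodesic S \<xi> \<and>
     (\<exists>N::int set. ad_eigenvalues (lie_algebra (grp S)) \<xi> = (\<lambda>\<nu>. \<i> * of_int \<nu>) ` N \<and> Gcd N = 1)"

definition extrinsically_symmetric_type :: "('m::finite) cmat sym_space \<Rightarrow> 'm cmat \<Rightarrow> bool" where
  "extrinsically_symmetric_type S \<xi> \<longleftrightarrow> canonical S \<xi> \<and>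
     (\<forall>X\<in>lie_algebra (grp S). bracket \<xi> (bracket \<xi> (bracket \<xi> X)) = - bracket \<xi> X)"

text \<open>\<open>K\<^sub>0\<close> is the identity component of \<open>K\<close>; it acts on \<open>M\<close> and on \<open>\<pp>\<close> through its image, the
  identity component of the isotropy group of \<open>eK\<close> in the isometry group of \<open>M\<close>.\<close>

definition Ad_orbit :: "('m::finite) cmat sym_space \<Rightarrow> 'm cmat \<Rightarrow> 'm cmat set" where
  "Ad_orbit S \<xi> = {k ** \<xi> ** matrix_inv k | k. k \<in> connected_component_set (isot S) (mat 1)}"

definition spindle :: "('m::finite) cmat sym_space \<Rightarrow> 'm cmat \<Rightarrow> real \<Rightarrow> 'm cmat set set" where
  "spindle S \<xi> t = (\<lambda>\<eta>. Exp S (t *\<^sub>R \<eta>)) ` Ad_orbit S \<xi>"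

definition period :: "('m::finite) cmat sym_space \<Rightarrow> 'm cmat \<Rightarrow> real" where
  "period S \<xi> = (THE T. T > 0 \<and> geodesic S \<xi> T = point S (mat 1) \<and>
     point S (mat 1) \<notin> geodesic S \<xi> ` {0<..<T})"

definition spindle_number :: "('m::finite) cmat sym_space \<Rightarrow> 'm cmat \<Rightarrow> nat" where
  "spindle_number S \<xi> = card {t \<in> {0..<period S \<xi>}. is_singleton (spindle S \<xi> t)}"


section \<open>The classical spaces and the elements of their Lie algebras\<close>

text \<open>In each case \<open>K\<close> is the group of fixed points of the involution in \<open>G\<close>, except in type BD I,
  where it is the identity component of that group.\<close>

definition diag_sign :: "('p::finite + 'q::finite) cmat" where
  "diag_sign = block (mat 1) 0 0 (- mat 1)"

definition space_AI :: "('m::finite) cmat sym_space" where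
  "space_AI = \<lparr> grp = SU, isot = SO, invol = cnj_mat \<rparr>"

definition space_AII :: "('n::finite + 'n) cmat sym_space" where
  "space_AII = \<lparr> grp = SU, isot = Sp, invol = (\<lambda>A. J ** cnj_mat A ** matrix_inv J) \<rparr>"

definition space_AIII :: "('n::finite + 'n) cmat sym_space" where
  "space_AIII = \<lparr> grp = SU, isot = {block A 0 0 B | A B. A \<in> U \<and> B \<in> U} \<inter> SU,
     invol = (\<lambda>A. diag_sign ** A ** matrix_inv diag_sign) \<rparr>"

definition space_BDI :: "('p::finite + 'q::finite) cmat sym_space" where
  "space_BDI = \<lparr> grp = SO, isot = {block A 0 0 B | A B. A \<in> SO \<and> B \<in> SO},
     invol = (\<lambda>A. diag_sign ** A ** matrix_inv diag_sign) \<rparr>"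

definition space_DIII :: "(('n::finite + 'n) + ('n + 'n)) cmat sym_space" where
  "space_DIII = \<lparr> grp = SO, isot = {A \<in> SO. A ** J = J ** A},
     invol = (\<lambda>A. J ** A ** matrix_inv J) \<rparr>"

definition space_CI :: "('n::finite + 'n) cmat sym_space" where
  "space_CI = \<lparr> grp = Sp, isot = Sp \<inter> SO, invol = cnj_mat \<rparr>"

definition diag_CII :: "(('n::finite + 'n) + ('n + 'n)) cmat" where
  "diag_CII = block diag_sign 0 0 diag_sign"

definition space_CII :: "(('n::finite + 'n) + ('n + 'n)) cmat sym_space" where
  "space_CII = \<lparr> grp = Sp, isot = {A \<in> Sp. A ** diag_CII = diag_CII ** A},
     invol = (\<lambda>A. diag_CII ** A ** matrix_inv diag_CII) \<rparr>"

definition xi_AI :: "('p::finite + 'q::finite) cmat" where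
  "xi_AI = (let a = - (real CARD('q) / real (CARD('p) + CARD('q)));
                b = real CARD('p) / real (CARD('p) + CARD('q))
            in block (mat (\<i> * of_real a)) 0 0 (mat (\<i> * of_real b)))"

definition xi_AII :: "(('p::finite + 'q::finite) + ('p + 'q)) cmat" where
  "xi_AII = block xi_AI 0 0 xi_AI"

definition xi_AIII :: "('n::finite + 'n) cmat" where
  "xi_AIII = block 0 (mat (\<i> / 2)) (mat (\<i> / 2)) 0"

text \<open>The index types carry no order, so the matrix \<open>E\<close> has its entry \<open>1\<close> at an arbitrary
  position \<open>(i, j)\<close>, which may be taken as position \<open>(1, 1)\<close>.\<close>

definition unit_entry :: "'p \<Rightarrow> 'q \<Rightarrow> complex^('q::finite)^('p::finite)" where
  "unit_entry i j = (\<chi> r c. if r = i \<and> c = j then 1 else 0)"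

definition xi_BDI_1 :: "'p \<Rightarrow> 'q \<Rightarrow> ('p::finite + 'q::finite) cmat" where
  "xi_BDI_1 i j = block 0 (unit_entry i j) (- transpose (unit_entry i j)) 0"

definition xi_BDI_2 :: "('n::finite + 'n) cmat" where
  "xi_BDI_2 = (1 / 2) *\<^sub>R J"

definition xi_DIII :: "(('n::finite + 'n) + ('n + 'n)) cmat" where
  "xi_DIII = (1 / 2) *\<^sub>R block J 0 0 (- J)"

definition xi_CI :: "('n::finite + 'n) cmat" where
  "xi_CI = block (mat (\<i> / 2)) 0 0 (- mat (\<i> / 2))"

definition xi_CII :: "(('n::finite + 'n) + ('n + 'n)) cmat" where
  "xi_CII = block 0 xi_AIII xi_AIII 0"

end

theory Submission
  imports Defs
begin

text \<open>Write \<open>g t = mexp (t *\<^sub>R \<xi>)\<close>, let \<open>\<sigma>\<close> be the Cartan involution, and let \<open>K\<^sub>0\<close> be the identity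
  component of the isotropy group \<open>K\<close>. The point \<open>k ** g t K\<close> of the spindle member at time \<open>t\<close>
  coincides with \<open>g t K\<close> iff \<open>g (- t) ** k ** g t \<in> K\<close>, so the member is a knot iff conjugation by
  \<open>g (- t)\<close> maps \<open>K\<^sub>0\<close> into \<open>K\<close>. Since \<open>\<sigma>\<close> fixes \<open>K\<close> and reverses \<open>g\<close>, this forces \<open>g (2 * t)\<close> to commute
  with \<open>K\<^sub>0\<close>. In each of the eight cases \<open>\<kk>\<close> contains an element \<open>Y\<close> with \<open>[\<xi>, [\<xi>, Y]] = - Y\<close>, which
  \<open>Ad (g t)\<close> rotates by the angle \<open>t\<close> in the plane spanned by \<open>Y\<close> and \<open>[\<xi>, Y]\<close>; commuting with
  \<open>g (2 * t)\<close> therefore requires \<open>sin t = 0\<close>. Conversely \<open>g pi\<close> normalises \<open>K\<close>, so the knots are exactly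
  the multiples of \<open>\<pi>\<close>. The endpoint of a period is such a multiple, and hence the spindle number is
  the least \<open>m > 0\<close> with \<open>g (m * pi) \<in> K\<close>. The plane of \<open>Y\<close> and \<open>[\<xi>, Y]\<close> also provides the eigenvalue
  \<open>\<i>\<close> of \<open>ad \<xi>\<close>, while \<open>ad \<xi> ^ 3 = - ad \<xi>\<close> leaves only \<open>0\<close> and \<open>\<plusminus>\<i>\<close>, so that \<open>\<xi>\<close> is canonical. All of
  this is the content of the locale \<open>spindle_data\<close>.

  It remains to find \<open>m\<close>. In types A III, BD I (second case), D III, C I and C II one has
  \<open>\<xi> ** \<xi> = - 1/4\<close>, hence \<open>g t = cos (t/2) + 2 sin (t/2) \<xi>\<close>; as \<open>\<sigma>\<close> negates \<open>\<xi>\<close>, the element \<open>g pi = 2 \<xi>\<close>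
  is not in \<open>K\<close>, and \<open>m\<close> is 2 or 4 according to whether \<open>- 1\<close> is in \<open>K\<close> (\<open>spindle_half_imaginary\<close>).
  In types A I and A II the matrix \<open>\<xi>\<close> is diagonal and \<open>g (m * pi) \<in> K\<close> means that all the numbers
  \<open>exp (\<i> * pi * m * w)\<close>, for the eigenvalues \<open>\<i> * w\<close> of \<open>\<xi>\<close>, are real (locale \<open>integral_weights\<close>). In the
  first case of BD I, \<open>g t\<close> rotates one coordinate plane by the angle \<open>t\<close>; \<open>g pi\<close> preserves the two
  blocks but reverses the orientation of each, so \<open>m = 2\<close> (\<open>spindle_BDI_1\<close>).

  Facts about \<open>mexp\<close> are obtained from the differential equation \<open>E' = X ** E\<close>: a matrix function with
  vanishing derivative is constant, and this gives the addition law, the closed forms above and the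
  membership of \<open>mexp X\<close> in the classical groups.\<close>


section \<open>The matrix exponential\<close>

lemma cmat_scaleR_mult [simp]:
  fixes A :: "complex^'n^'m" and B :: "complex^'k^'n"
  shows "(c *\<^sub>R A) ** B = c *\<^sub>R (A ** B)" "A ** (c *\<^sub>R B) = c *\<^sub>R (A ** B)"
  by (simp_all add: matrix_matrix_mult_def vec_eq_iff scaleR_sum_right)

lemma cmat_minus_mult [simp]:
  fixes A :: "complex^'n^'m" and B :: "complex^'k^'n"
  shows "(- A) ** B = - (A ** B)" "A ** (- B) = - (A ** B)"
  by (simp_all add: matrix_matrix_mult_def vec_eq_iff sum_negf)

lemma cmat_distrib:
  fixes A A' :: "complex^'n^'m" and B B' :: "complex^'k^'n"
  shows "(A + A') ** B = A ** B + A' ** B" "A ** (B + B') = A ** B + A ** B'"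
    "(A - A') ** B = A ** B - A' ** B" "A ** (B - B') = A ** B - A ** B'"
  by (simp_all add: matrix_matrix_mult_def vec_eq_iff sum.distrib sum_subtractf algebra_simps)

lemma cmat_zero_mult [simp]:
  fixes A :: "complex^'n^'m" and B :: "complex^'k^'n"
  shows "0 ** B = (0 :: complex^'k^'m)" "A ** 0 = (0 :: complex^'k^'m)"
  by (simp_all add: matrix_matrix_mult_def vec_eq_iff)

lemma bounded_bilinear_cmat:
  "bounded_bilinear ((**) :: ('m::finite) cmat \<Rightarrow> 'm cmat \<Rightarrow> 'm cmat)"
  unfolding bilinear_conv_bounded_bilinear [symmetric] bilinear_def
  by (auto intro!: linearI simp: cmat_distrib)

abbreviation mpow :: "('m::finite) cmat \<Rightarrow> nat \<Rightarrow> 'm cmat" where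
  "mpow X k \<equiv> ((**) X ^^ k) (mat 1)"

lemma mpow_scaleR: "mpow (t *\<^sub>R X) k = t ^ k *\<^sub>R mpow X k"
  by (induction k) (simp_all add: mult.commute)

lemma mpow_bound:
  fixes X :: "('m::finite) cmat"
  shows "\<exists>C>0. \<forall>k. norm (mpow X k) \<le> norm (mat 1 :: 'm cmat) * C ^ k"
proof -
  obtain K where K: "K > 0" "\<forall>(A :: 'm cmat) (B :: 'm cmat). norm (A ** B) \<le> norm A * norm B * K"
    using bounded_bilinear.pos_bounded[OF bounded_bilinear_cmat] by auto
  define C where "C = norm X * K + 1"
  have C: "C > 0" "norm X * K \<le> C"
  proof -
    have "0 \<le> norm X * K" using K(1) by simp
    then show "C > 0" "norm X * K \<le> C" by (simp_all add: C_def)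
  qed
  have "norm (mpow X k) \<le> norm (mat 1 :: 'm cmat) * C ^ k" for k
  proof (induction k)
    case 0
    show ?case by simp
  next
    case (Suc k)
    have "norm (mpow X (Suc k)) \<le> (norm X * K) * norm (mpow X k)"
      using K(2)[rule_format, of X "mpow X k"] by (simp add: mult_ac)
    also have "\<dots> \<le> C * (norm (mat 1 :: 'm cmat) * C ^ k)"
      using Suc C by (intro mult_mono) auto
    finally show ?case by (simp add: mult_ac)
  qed
  with C(1) show ?thesis by (intro exI[of _ C]) simp
qed

lemma mexp_summable_norm:
  fixes X :: "('m::finite) cmat"
  shows "summable (\<lambda>k. norm ((1 / fact k) *\<^sub>R mpow X k))"
proof -
  obtain C where C: "C > 0" "\<And>k. norm (mpow X k) \<le> norm (mat 1 :: 'm cmat) * C ^ k"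
    using mpow_bound[of X] by auto
  have "summable (\<lambda>k. norm (mat 1 :: 'm cmat) * (inverse (fact k) * C ^ k))"
    by (intro summable_mult summable_exp)
  then show ?thesis
  proof (rule summable_comparison_test'[where N = 0])
    fix k :: nat
    have "norm (norm ((1 / fact k) *\<^sub>R mpow X k)) = inverse (fact k) * norm (mpow X k)"
      by (simp add: inverse_eq_divide)
    also have "\<dots> \<le> inverse (fact k) * (norm (mat 1 :: 'm cmat) * C ^ k)"
      by (intro mult_left_mono C) simp
    also have "\<dots> = norm (mat 1 :: 'm cmat) * (inverse (fact k) * C ^ k)"
      by (rule mult.left_commute)
    finally show "norm (norm ((1 / fact k) *\<^sub>R mpow X k)) \<le>
      norm (mat 1 :: 'm cmat) * (inverse (fact k) * C ^ k)" .
  qed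
qed

lemma mexp_sums: "(\<lambda>k. (1 / fact k) *\<^sub>R mpow X k) sums mexp X"
  unfolding mexp_def using summable_norm_cancel[OF mexp_summable_norm] by (rule summable_sums)

lemma mexp_0 [simp]: "mexp 0 = (mat 1 :: ('m::finite) cmat)"
proof -
  have "(1 / fact k) *\<^sub>R mpow (0 :: 'm cmat) k = (if k = 0 then mat 1 else 0)" for k
    by (cases k) auto
  then have "(\<lambda>k. if k = 0 then mat 1 else 0) sums mexp (0 :: 'm cmat)"
    using mexp_sums[of "0 :: 'm cmat"] by simp
  then show ?thesis using sums_single[of 0 "\<lambda>_. mat 1 :: 'm cmat"] sums_unique2 by force
qed

text \<open>Covers complex conjugation, conjugation by an invertible matrix and the Cartan involutions:
  the exponential series is carried over term by term.\<close>

lemma mexp_homomorphism: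
  fixes f :: "('m::finite) cmat \<Rightarrow> ('n::finite) cmat"
  assumes "linear f" "\<And>A B. f (A ** B) = f A ** f B" "f (mat 1) = mat 1"
  shows "f (mexp X) = mexp (f X)"
proof -
  interpret linear f by fact
  have "f (mpow X k) = mpow (f X) k" for k
    by (induction k) (simp_all add: assms)
  then have "(\<lambda>k. (1 / fact k) *\<^sub>R mpow (f X) k) sums f (mexp X)"
    using bounded_linear.sums[OF linear_conv_bounded_linear[THEN iffD1, OF \<open>linear f\<close>] mexp_sums[of X]]
    by (simp add: scale)
  then show ?thesis using mexp_sums sums_unique2 by blast
qed

lemma has_vector_derivative_cmatI:
  fixes f :: "real \<Rightarrow> ('m::finite) cmat"
  assumes "\<And>i j. ((\<lambda>t. f t $ i $ j) has_vector_derivative (f' $ i $ j)) (at t within S)"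
  shows "(f has_vector_derivative f') (at t within S)"
  unfolding has_vector_derivative_def
proof (subst has_derivative_componentwise_within, intro ballI)
  fix b :: "'m cmat" assume "b \<in> Basis"
  then obtain i j u where "b = axis i (axis j u)"
    by (auto simp: Basis_vec_def)
  moreover have "((\<lambda>t. (f t $ i $ j) \<bullet> u) has_derivative (\<lambda>x. (x *\<^sub>R (f' $ i $ j)) \<bullet> u)) (at t within S)"
    using assms[of i j] unfolding has_vector_derivative_def by (rule has_derivative_inner_left)
  ultimately show "((\<lambda>t. f t \<bullet> b) has_derivative (\<lambda>x. (x *\<^sub>R f') \<bullet> b)) (at t within S)"
    by (simp add: inner_axis)
qed

text \<open>Each entry of \<open>mexp (t *\<^sub>R X)\<close> is an everywhere convergent scalar power series in \<open>t\<close>, so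
  termwise differentiation of scalar series suffices.\<close>

lemma mexp_has_vector_derivative:
  fixes X :: "('m::finite) cmat"
  shows "((\<lambda>t. mexp (t *\<^sub>R X)) has_vector_derivative (X ** mexp (t *\<^sub>R X))) (at t within S)"
proof (rule has_vector_derivative_cmatI)
  fix i j
  define c where "c = (\<lambda>k. (1 / fact k) *\<^sub>R (mpow X k $ i $ j))"
  have c: "((1 / fact k) *\<^sub>R mpow (s *\<^sub>R X) k) $ i $ j = c k * of_real s ^ k" for s k
    by (simp add: c_def mpow_scaleR scaleR_conv_of_real[where 'a = complex])
  have c': "((1 / fact k) *\<^sub>R (X ** mpow (s *\<^sub>R X) k)) $ i $ j = diffs c k * of_real s ^ k" for s k
  proof -
    have "(1 / fact k :: real) = of_nat (Suc k) * (1 / fact (Suc k))"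
      by (simp del: of_nat_Suc)
    then have "diffs c k = (1 / fact k) *\<^sub>R (mpow X (Suc k) $ i $ j)"
      by (simp add: c_def diffs_def scaleR_conv_of_real[where 'a = complex] del: of_nat_Suc fact_Suc)
    then show ?thesis
      by (simp add: mpow_scaleR scaleR_conv_of_real[where 'a = complex])
  qed
  have entry: "(\<lambda>k. c k * of_real s ^ k) sums (mexp (s *\<^sub>R X) $ i $ j)" for s :: real
    using sums_vec_nth[OF sums_vec_nth[OF mexp_sums[of "s *\<^sub>R X"], of i], of j]
    by (simp only: c)
  have "summable (\<lambda>k. c k * y ^ k)" for y
  proof (rule summable_comparison_test'[where N = 0])
    show "summable (\<lambda>k. norm ((1 / fact k) *\<^sub>R mpow (norm y *\<^sub>R X) k))"
      by (rule mexp_summable_norm)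
    fix k
    have "norm (c k * y ^ k) = norm (((1 / fact k) *\<^sub>R mpow (norm y *\<^sub>R X) k) $ i $ j)"
      unfolding c by (simp add: norm_mult norm_power)
    also have "\<dots> \<le> norm ((1 / fact k) *\<^sub>R mpow (norm y *\<^sub>R X) k)"
      by (rule order_trans[OF Finite_Cartesian_Product.norm_nth_le Finite_Cartesian_Product.norm_nth_le])
    finally show "norm (c k * y ^ k) \<le> norm ((1 / fact k) *\<^sub>R mpow (norm y *\<^sub>R X) k)" .
  qed
  then have "((\<lambda>x. \<Sum>k. c k * x ^ k) has_field_derivative (\<Sum>k. diffs c k * of_real t ^ k)) (at (of_real t))"
    by (rule termdiffs_strong_converges_everywhere)
  then have "((\<lambda>s. \<Sum>k. c k * of_real s ^ k) has_vector_derivative (\<Sum>k. diffs c k * of_real t ^ k))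
      (at t within S)"
    by (rule has_vector_derivative_real_field)
  moreover have "(\<lambda>k. diffs c k * of_real t ^ k) sums ((X ** mexp (t *\<^sub>R X)) $ i $ j)"
  proof -
    have "(\<lambda>k. X ** ((1 / fact k) *\<^sub>R mpow (t *\<^sub>R X) k)) sums (X ** mexp (t *\<^sub>R X))"
      by (intro bounded_linear.sums[OF bounded_bilinear.bounded_linear_right[OF bounded_bilinear_cmat]]
          mexp_sums)
    from sums_vec_nth[OF sums_vec_nth[OF this, of i], of j] show ?thesis
      by (simp only: cmat_scaleR_mult c')
  qed
  ultimately show "((\<lambda>t. mexp (t *\<^sub>R X) $ i $ j) has_vector_derivative (X ** mexp (t *\<^sub>R X)) $ i $ j)
      (at t within S)"
    by (simp only: sums_unique[OF entry] sums_iff)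
qed

lemmas cmat_has_vector_derivative_mult = bounded_bilinear.has_vector_derivative[OF bounded_bilinear_cmat]

lemma has_vector_derivative_zero_eq:
  fixes f :: "real \<Rightarrow> 'a::real_normed_vector"
  assumes "\<And>t. (f has_vector_derivative 0) (at t)"
  shows "f s = f t"
  using has_vector_derivative_zero_constant[of UNIV f] assms by (metis UNIV_I convex_UNIV)

lemma mpow_commute: "A ** X = X ** A \<Longrightarrow> A ** mpow X k = mpow X k ** A"
proof (induction k)
  case (Suc k)
  then show ?case by (simp add: matrix_mul_assoc) (simp add: matrix_mul_assoc[symmetric])
qed simp

lemma mexp_commute:
  assumes "A ** X = X ** A"
  shows "A ** mexp X = mexp X ** A"
proof -
  have "(\<lambda>k. A ** ((1 / fact k) *\<^sub>R mpow X k)) sums (A ** mexp X)"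
    by (intro bounded_linear.sums[OF bounded_bilinear.bounded_linear_right[OF bounded_bilinear_cmat]]
        mexp_sums)
  moreover have "(\<lambda>k. ((1 / fact k) *\<^sub>R mpow X k) ** A) sums (mexp X ** A)"
    by (intro bounded_linear.sums[OF bounded_bilinear.bounded_linear_left[OF bounded_bilinear_cmat]]
        mexp_sums)
  ultimately show ?thesis by (simp add: mpow_commute[OF assms] sums_unique2)
qed

lemma mexp_minus_has_vector_derivative:
  "((\<lambda>t. mexp (- (t *\<^sub>R X))) has_vector_derivative (- (mexp (- (t *\<^sub>R X)) ** X))) (at t within S)"
  using mexp_has_vector_derivative[of "- X" t S] mexp_commute[of X "- (t *\<^sub>R X)"]
  by simp

text \<open>Multiplying a solution by the inverse of the fundamental solution removes the time
  dependence. With \<open>F t = mexp (t *\<^sub>R X)\<close> this shows that \<open>mexp (- X)\<close> is the inverse of \<open>mexp X\<close>.\<close>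

lemma mexp_ode_invariant:
  fixes F :: "real \<Rightarrow> ('m::finite) cmat"
  assumes "\<And>t. (F has_vector_derivative X ** F t) (at t)"
  shows "mexp (- (t *\<^sub>R X)) ** F t = F 0"
proof -
  have "((\<lambda>t. mexp (- (t *\<^sub>R X)) ** F t) has_vector_derivative 0) (at t)" for t
    by (rule has_vector_derivative_eq_rhs
        [OF cmat_has_vector_derivative_mult[OF mexp_minus_has_vector_derivative assms]])
      (simp add: matrix_mul_assoc)
  from has_vector_derivative_zero_eq[OF this, of t 0] show ?thesis by simp
qed

lemma mexp_minus_left [simp]: "mexp (- X) ** mexp X = mat 1"
  using mexp_ode_invariant[OF mexp_has_vector_derivative, of 1 X] by simp

lemma mexp_minus_right [simp]: "mexp X ** mexp (- X) = mat 1"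
  using mexp_minus_left[of "- X"] by simp

lemma mexp_ode_unique:
  fixes F :: "real \<Rightarrow> ('m::finite) cmat"
  assumes "\<And>t. (F has_vector_derivative X ** F t) (at t)"
  shows "F t = mexp (t *\<^sub>R X) ** F 0"
  unfolding mexp_ode_invariant[OF assms, of t, symmetric] by (simp add: matrix_mul_assoc)

lemma mexp_add: "mexp ((s + t) *\<^sub>R X) = mexp (s *\<^sub>R X) ** mexp (t *\<^sub>R X)"
proof -
  have "((\<lambda>s. mexp ((s + t) *\<^sub>R X)) has_vector_derivative X ** mexp ((s + t) *\<^sub>R X)) (at s)" for s
    using vector_diff_chain_at[of "\<lambda>s. s + t" 1 s "\<lambda>t. mexp (t *\<^sub>R X)", OF _ mexp_has_vector_derivative]
    by (simp add: o_def has_vector_derivative_add_const)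
  from mexp_ode_unique[OF this, of s] show ?thesis by simp
qed

section \<open>Exponentials in the classical groups\<close>

lemma linear_cnj_mat: "linear (cnj_mat :: ('m::finite) cmat \<Rightarrow> 'm cmat)"
  by (intro linearI) (simp_all add: cnj_mat_def vec_eq_iff)

lemma cnj_mat_mult: "cnj_mat (A ** B) = cnj_mat A ** cnj_mat B"
  by (simp add: cnj_mat_def matrix_matrix_mult_def vec_eq_iff)

lemma cnj_mat_simps [simp]:
  "cnj_mat (mat 1) = mat 1" "cnj_mat 0 = 0" "cnj_mat (- A) = - cnj_mat A"
  "cnj_mat (c *\<^sub>R A) = c *\<^sub>R cnj_mat A" "cnj_mat (cnj_mat A) = A"
  "cnj_mat (transpose A) = transpose (cnj_mat A)"
  "cnj_mat (A + B) = cnj_mat A + cnj_mat B" "cnj_mat (A - B) = cnj_mat A - cnj_mat B"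
  by (auto simp: cnj_mat_def vec_eq_iff mat_def transpose_def)

lemma cnj_mat_eq_iff_real: "cnj_mat A = A \<longleftrightarrow> (\<forall>i j. A $ i $ j \<in> \<real>)"
  by (simp add: cnj_mat_def vec_eq_iff Reals_cnj_iff)

lemma transpose_simps [simp]:
  "transpose 0 = 0"
  "transpose (- A) = - transpose (A :: complex^'n^'m)"
  "transpose (A + B) = transpose A + transpose (B :: complex^'n^'m)"
  "transpose (A - B) = transpose A - transpose (B :: complex^'n^'m)"
  by (auto simp: vec_eq_iff transpose_def)

lemma linear_transpose: "linear (transpose :: ('m::finite) cmat \<Rightarrow> 'm cmat)"
  by (intro linearI) (simp_all add: transpose_scalar)

text \<open>The derivative of \<open>f (mexp (t *\<^sub>R X)) ** Q ** mexp (t *\<^sub>R X)\<close> contains the factor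
  \<open>f X ** Q + Q ** X\<close>. The map \<open>f\<close> is the transpose or the conjugate transpose below.\<close>

lemma mexp_preserves_form:
  fixes f :: "('m::finite) cmat \<Rightarrow> 'm cmat"
  assumes f: "linear f" "\<And>A B. f (A ** B) = f B ** f A" "f (mat 1) = mat 1"
    and X: "f X ** Q + Q ** X = 0"
  shows "f (mexp X) ** Q ** mexp X = Q"
proof -
  let ?E = "\<lambda>t::real. mexp (t *\<^sub>R X)"
  have "((\<lambda>t. f (?E t) ** (Q ** ?E t)) has_vector_derivative 0) (at t)" for t
  proof (rule has_vector_derivative_eq_rhs)
    have "((\<lambda>t. f (?E t)) has_vector_derivative f (X ** ?E t)) (at t)"
      by (rule bounded_linear.has_vector_derivative
          [OF linear_conv_bounded_linear[THEN iffD1, OF f(1)] mexp_has_vector_derivative])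
    moreover have "((\<lambda>t. Q ** ?E t) has_vector_derivative Q ** (X ** ?E t)) (at t)"
      by (rule bounded_linear.has_vector_derivative
          [OF bounded_bilinear.bounded_linear_right[OF bounded_bilinear_cmat] mexp_has_vector_derivative])
    ultimately show "((\<lambda>t. f (?E t) ** (Q ** ?E t)) has_vector_derivative
        f (?E t) ** (Q ** (X ** ?E t)) + f (X ** ?E t) ** (Q ** ?E t)) (at t)"
      by (rule cmat_has_vector_derivative_mult)
    have "f (?E t) ** (Q ** (X ** ?E t)) + f (X ** ?E t) ** (Q ** ?E t)
        = f (?E t) ** ((f X ** Q + Q ** X) ** ?E t)"
      by (simp add: f cmat_distrib matrix_mul_assoc)
    then show "f (?E t) ** (Q ** (X ** ?E t)) + f (X ** ?E t) ** (Q ** ?E t) = 0"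
      by (simp add: X)
  qed
  from has_vector_derivative_zero_eq[OF this, of 1 0] show ?thesis
    by (simp add: f matrix_mul_assoc)
qed

lemma mexp_in_U:
  assumes "transpose (cnj_mat X) = - X"
  shows "mexp X \<in> U"
proof -
  have "linear (\<lambda>A :: 'a cmat. transpose (cnj_mat A))"
    using linear_compose[OF linear_cnj_mat linear_transpose] by (simp add: o_def)
  then have "transpose (cnj_mat (mexp X)) ** mat 1 ** mexp X = mat 1"
    by (rule mexp_preserves_form) (simp_all add: assms cnj_mat_mult matrix_transpose_mul)
  then show ?thesis by (simp add: U_def)
qed

lemma mexp_in_Sp:
  assumes "transpose (cnj_mat X) = - X" "transpose X ** J + J ** X = 0"
  shows "mexp X \<in> Sp"
  using mexp_in_U[OF assms(1)] mexp_preserves_form[OF linear_transpose _ _ assms(2)]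
  by (simp add: Sp_def matrix_transpose_mul)

text \<open>A substitute for \<open>det (mexp X) = exp (trace X)\<close>: \<open>mexp X\<close> is the square of \<open>mexp (X / 2)\<close>, so
  it is enough to know the determinants up to sign.\<close>

lemma det_mexp_eq_1:
  assumes "\<And>t::real. det (mexp (t *\<^sub>R X)) * det (mexp (t *\<^sub>R X)) = 1"
  shows "det (mexp X) = 1"
  using mexp_add[of "1/2" "1/2" X] assms[of "1/2"] by (simp add: det_mul)

lemma cnj_mat_mexp: "cnj_mat (mexp X) = mexp (cnj_mat X)"
  by (intro mexp_homomorphism linear_cnj_mat) (simp_all add: cnj_mat_mult)

lemma mexp_in_SO:
  assumes "cnj_mat X = X" "transpose X = - X"
  shows "mexp X \<in> SO"
proof -
  have orth: "transpose (mexp (t *\<^sub>R X)) ** mexp (t *\<^sub>R X) = mat 1" for t :: real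
    using mexp_in_U[of "t *\<^sub>R X"] by (simp add: U_def cnj_mat_mexp assms transpose_scalar)
  have "det (mexp X) = 1"
  proof (rule det_mexp_eq_1)
    show "det (mexp (t *\<^sub>R X)) * det (mexp (t *\<^sub>R X)) = 1" for t :: real
      using arg_cong[OF orth[of t], of det] by (simp add: det_mul)
  qed
  then show ?thesis
    using orth[of 1] by (simp add: SO_def cnj_mat_eq_iff_real[symmetric] cnj_mat_mexp assms)
qed

lemma SO_subset_SU: "SO \<subseteq> SU"
  by (auto simp: SO_def SU_def U_def cnj_mat_eq_iff_real[symmetric])

lemma conj_involution:
  fixes P Q :: "('m::finite) cmat"
  assumes "Q ** P = mat 1"
  shows "linear (\<lambda>A. P ** A ** Q)" "P ** (A ** B) ** Q = (P ** A ** Q) ** (P ** B ** Q)"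
    "P ** mat 1 ** Q = mat 1"
proof -
  show "linear (\<lambda>A. P ** A ** Q)" by (intro linearI) (simp_all add: cmat_distrib)
  have "(P ** A ** Q) ** (P ** B ** Q) = P ** A ** (Q ** P) ** B ** Q" by (simp add: matrix_mul_assoc)
  then show "P ** (A ** B) ** Q = (P ** A ** Q) ** (P ** B ** Q)" by (simp add: assms matrix_mul_assoc)
  show "P ** mat 1 ** Q = mat 1" using matrix_left_right_inverse[THEN iffD1, OF assms] by simp
qed

lemma mexp_conj:
  fixes P Q :: "('m::finite) cmat"
  assumes "Q ** P = mat 1"
  shows "mexp (P ** X ** Q) = P ** mexp X ** Q"
  by (rule mexp_homomorphism[symmetric]) (fact conj_involution[OF assms(1)])+

text \<open>Tracelessness enters through a matrix \<open>P\<close> that anticommutes with \<open>X\<close>: it conjugates \<open>mexp X\<close> to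
  its inverse, so the determinant is \<open>\<plusminus>1\<close>.\<close>

lemma mexp_in_SU:
  fixes X P Q :: "('m::finite) cmat"
  assumes "transpose (cnj_mat X) = - X"
    and PQ: "Q ** P = mat 1" "P ** X = - (X ** P)"
  shows "mexp X \<in> SU"
proof -
  have QP: "P ** Q = mat 1" using PQ(1) by (rule matrix_left_right_inverse[THEN iffD1])
  have "det (mexp X) = 1"
  proof (rule det_mexp_eq_1)
    fix t :: real
    have "P ** (t *\<^sub>R X) ** Q = - (t *\<^sub>R X)"
      using QP by (simp add: PQ matrix_mul_assoc[symmetric])
    then have "mexp (- (t *\<^sub>R X)) = P ** mexp (t *\<^sub>R X) ** Q"
      using mexp_conj[OF PQ(1), of "t *\<^sub>R X"] by simp
    then have "det (mexp (- (t *\<^sub>R X))) = det P * det Q * det (mexp (t *\<^sub>R X))"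
      by (simp add: det_mul)
    moreover have "det P * det Q = 1" using arg_cong[OF QP, of det] by (simp add: det_mul)
    moreover have "det (mexp (- (t *\<^sub>R X))) * det (mexp (t *\<^sub>R X)) = 1"
      by (simp flip: det_mul)
    ultimately show "det (mexp (t *\<^sub>R X)) * det (mexp (t *\<^sub>R X)) = 1" by simp
  qed
  with mexp_in_U[OF assms(1)] show ?thesis by (simp add: SU_def)
qed

text \<open>Differentiate the orthogonality relation of \<open>mexp (t *\<^sub>R X)\<close> at \<open>t = 0\<close>.\<close>

lemma lie_algebra_SO_antisymmetric:
  assumes "X \<in> lie_algebra SO"
  shows "transpose X = - X"
proof -
  let ?F = "\<lambda>t::real. transpose (mexp (t *\<^sub>R X)) ** mexp (t *\<^sub>R X)"
  have "((\<lambda>t. transpose (mexp (t *\<^sub>R X))) has_vector_derivative transpose (X ** mexp (0 *\<^sub>R X))) (at 0)"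
    by (rule bounded_linear.has_vector_derivative
        [OF linear_conv_bounded_linear[THEN iffD1, OF linear_transpose] mexp_has_vector_derivative])
  from cmat_has_vector_derivative_mult[OF this mexp_has_vector_derivative]
  have "(?F has_vector_derivative X + transpose X) (at 0)" by simp
  moreover have "?F = (\<lambda>t. mat 1)"
    using assms by (auto simp: lie_algebra_def SO_def)
  ultimately have "X + transpose X = 0"
    by (metis has_vector_derivative_const vector_derivative_unique_at)
  then show ?thesis by (simp add: eq_neg_iff_add_eq_0 add.commute)
qed

section \<open>Knots and periods of a spindle\<close>

text \<open>The pair \<open>(X, Y)\<close> stands for an eigenvector \<open>X + iY\<close> in the complexification, and
  \<open>T ^ 3 = - T\<close> forces \<open>\<mu> ^ 3 = - \<mu>\<close>.\<close>

lemma eigenvalue_cases: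
  fixes T :: "'a::real_vector \<Rightarrow> 'a"
  assumes T: "linear T" and nz: "X \<noteq> 0 \<or> Y \<noteq> 0"
    and X: "T X = Re \<mu> *\<^sub>R X - Im \<mu> *\<^sub>R Y" and Y: "T Y = Im \<mu> *\<^sub>R X + Re \<mu> *\<^sub>R Y"
    and cubic: "T (T (T X)) = - T X" "T (T (T Y)) = - T Y"
  shows "\<mu> \<in> {0, \<i>, - \<i>}"
proof -
  interpret linear T by fact
  \<comment> \<open>\<open>P \<nu>\<close> and \<open>Q \<nu>\<close> are the components of the formal multiple \<open>\<nu> (X + iY)\<close>.\<close>
  define P where "P = (\<lambda>\<nu>. Re \<nu> *\<^sub>R X - Im \<nu> *\<^sub>R Y)"
  define Q where "Q = (\<lambda>\<nu>. Im \<nu> *\<^sub>R X + Re \<nu> *\<^sub>R Y)"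
  have T: "T (P \<nu>) = P (\<mu> * \<nu>)" "T (Q \<nu>) = Q (\<mu> * \<nu>)" for \<nu>
    by (simp_all add: P_def Q_def diff add scale X Y algebra_simps)
  have PQ1: "X = P 1" "Y = Q 1" by (simp_all add: P_def Q_def)
  define \<kappa> where "\<kappa> = \<mu> * (\<mu> * \<mu>) + \<mu>"
  have "P (\<mu> * (\<mu> * \<mu>)) = - P \<mu>" "Q (\<mu> * (\<mu> * \<mu>)) = - Q \<mu>"
    using cubic unfolding PQ1 T by simp_all
  then have eqs: "P \<kappa> = 0" "Q \<kappa> = 0"
    by (simp_all add: P_def Q_def \<kappa>_def algebra_simps)
  have "((Re \<kappa>)\<^sup>2 + (Im \<kappa>)\<^sup>2) *\<^sub>R X = Re \<kappa> *\<^sub>R P \<kappa> + Im \<kappa> *\<^sub>R Q \<kappa>"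
    "((Re \<kappa>)\<^sup>2 + (Im \<kappa>)\<^sup>2) *\<^sub>R Y = Re \<kappa> *\<^sub>R Q \<kappa> - Im \<kappa> *\<^sub>R P \<kappa>"
    by (simp_all add: P_def Q_def algebra_simps power2_eq_square)
  with nz eqs have "(Re \<kappa>)\<^sup>2 + (Im \<kappa>)\<^sup>2 = 0"
    by auto
  then have "\<kappa> = 0"
    by (simp add: complex_eq_iff sum_power2_eq_zero_iff)
  then have "\<mu> * ((\<mu> - \<i>) * (\<mu> + \<i>)) = 0"
    by (simp add: \<kappa>_def algebra_simps)
  then show ?thesis by (auto simp: eq_neg_iff_add_eq_0)
qed

lemma linear_bracket: "linear (bracket A)"
  by (intro linearI) (simp_all add: bracket_def cmat_distrib algebra_simps)

lemma bracket_simps [simp]: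
  "bracket A (B + C) = bracket A B + bracket A C" "bracket A (B - C) = bracket A B - bracket A C"
  "bracket A (- B) = - bracket A B" "bracket A 0 = 0" "bracket A (c *\<^sub>R B) = c *\<^sub>R bracket A B"
  by (simp_all add: bracket_def cmat_distrib algebra_simps)

lemma matrix_inv_eqI:
  fixes A B :: "('m::finite) cmat"
  assumes "A ** B = mat 1"
  shows "matrix_inv A = B"
proof -
  have "B ** A = mat 1" using assms by (rule matrix_left_right_inverse[THEN iffD1])
  with assms have ex: "\<exists>A'. A ** A' = mat 1 \<and> A' ** A = mat 1" by blast
  have "matrix_inv A ** A = mat 1"
    unfolding matrix_inv_def using someI_ex[OF ex] by simp
  then have "matrix_inv A ** (A ** B) = B" by (simp add: matrix_mul_assoc)
  with assms show ?thesis by simp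
qed

lemma int_pi:
  fixes i :: int
  shows "0 \<le> of_int i * pi \<longleftrightarrow> 0 \<le> i" "0 < of_int i * pi \<longleftrightarrow> 0 < i"
    "of_int i * pi < real n * pi \<longleftrightarrow> i < int n"
  using not_le[of pi 0] not_less[of pi 0]
  by (auto simp: zero_le_mult_iff zero_less_mult_iff simp del: not_le not_less)

locale symmetric_pair =
  fixes S :: "('m::finite) cmat sym_space"
  assumes invol_linear: "linear (invol S)"
    and invol_mult: "\<And>A B. invol S (A ** B) = invol S A ** invol S B"
    and invol_one: "invol S (mat 1) = mat 1"
    and grp_mult: "\<And>A B. A \<in> grp S \<Longrightarrow> B \<in> grp S \<Longrightarrow> A ** B \<in> grp S"
    and isot_one: "mat 1 \<in> isot S"
    and isot_mult: "\<And>A B. A \<in> isot S \<Longrightarrow> B \<in> isot S \<Longrightarrow> A ** B \<in> isot S"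
    and isot_inv: "\<And>A. A \<in> isot S \<Longrightarrow> \<exists>B\<in>isot S. A ** B = mat 1"
    and isot_fixed: "\<And>A. A \<in> isot S \<Longrightarrow> invol S A = A"

text \<open>The element \<open>Y\<close> of \<open>\<kk>\<close> detects the times that are not multiples of \<open>\<pi>\<close>; \<open>half_turn\<close> says that
  multiples of \<open>\<pi>\<close> do give knots, and by \<open>m_first\<close> the time \<open>m * pi\<close> is the first positive multiple
  at which the geodesic is back at its origin.\<close>

locale spindle_data = symmetric_pair S for S :: "('m::finite) cmat sym_space" +
  fixes \<xi> Y :: "'m cmat" and m :: nat
  assumes xi_grp: "\<And>t::real. mexp (t *\<^sub>R \<xi>) \<in> grp S"
    and xi_invol: "invol S \<xi> = - \<xi>"
    and cubic: "\<And>X. X \<in> lie_algebra (grp S) \<Longrightarrow>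
      bracket \<xi> (bracket \<xi> (bracket \<xi> X)) = - bracket \<xi> X"
    and Y_nz: "Y \<noteq> 0"
    and Y_bracket: "bracket \<xi> (bracket \<xi> Y) = - Y"
    and Y_grp: "\<And>t::real. mexp (t *\<^sub>R Y) \<in> grp S"
    and Y_isot: "\<And>t::real. mexp (t *\<^sub>R Y) \<in> isot S"
    and half_turn: "\<And>A. A \<in> isot S \<Longrightarrow> mexp (- (pi *\<^sub>R \<xi>)) ** A ** mexp (pi *\<^sub>R \<xi>) \<in> isot S"
    and m_pos: "m > 0"
    and m_first: "\<And>j. 0 < j \<Longrightarrow> j \<le> m \<Longrightarrow> mexp ((real j * pi) *\<^sub>R \<xi>) \<in> isot S \<longleftrightarrow> j = m"
begin

definition g :: "real \<Rightarrow> 'm cmat" where "g t = mexp (t *\<^sub>R \<xi>)"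

abbreviation Z :: "'m cmat" where "Z \<equiv> bracket \<xi> Y"

lemma g_add: "g (s + t) = g s ** g t"
  by (simp add: g_def mexp_add)

lemma g_0 [simp]: "g 0 = mat 1"
  by (simp add: g_def)

lemma g_inv [simp]: "g (- t) ** g t = mat 1" "g t ** g (- t) = mat 1"
  by (simp_all flip: g_add)

lemma g_inv_assoc [simp]: "A ** g (- t) ** g t = A" "A ** g t ** g (- t) = A"
  by (simp_all flip: matrix_mul_assoc)

lemma g_cancel: "g t ** A = g t ** B \<longleftrightarrow> A = B" "A ** g t = B ** g t \<longleftrightarrow> A = B"
  by (metis g_inv(1) matrix_mul_assoc matrix_mul_lid) (metis g_inv_assoc(2))

text \<open>The curve \<open>W t = cos t Y + sin t [\<xi>, Y]\<close> satisfies \<open>W' = [\<xi>, W]\<close>, so \<open>g (- t) ** W t ** g t\<close> is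
  constant: \<open>Ad (g t)\<close> acts on the plane of \<open>Y\<close> and \<open>[\<xi>, Y]\<close> as the rotation by \<open>t\<close>.\<close>

lemma g_rotates_Y: "g t ** Y = (cos t *\<^sub>R Y + sin t *\<^sub>R Z) ** g t"
proof -
  define W where "W = (\<lambda>t. cos t *\<^sub>R Y + sin t *\<^sub>R Z)"
  define W' where "W' = (\<lambda>t. - sin t *\<^sub>R Y + cos t *\<^sub>R Z)"
  have W: "(W has_vector_derivative W' t) (at t)" for t
    unfolding W_def W'_def by (auto intro!: derivative_eq_intros)
  have "bracket \<xi> (W t) = W' t" for t
    by (simp add: W_def W'_def Y_bracket)
  then have W': "W' t = \<xi> ** W t - W t ** \<xi>" for t by (simp add: bracket_def)
  have "((\<lambda>t. g (- t) ** (W t ** g t)) has_vector_derivative 0) (at t)" for t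
  proof (rule has_vector_derivative_eq_rhs)
    show "((\<lambda>t. g (- t) ** (W t ** g t)) has_vector_derivative
        g (- t) ** (W t ** (\<xi> ** g t) + W' t ** g t) + (- (g (- t) ** \<xi>)) ** (W t ** g t)) (at t)"
      unfolding g_def scaleR_minus_left
      by (intro cmat_has_vector_derivative_mult mexp_minus_has_vector_derivative W
          mexp_has_vector_derivative)
  qed (simp add: W' cmat_distrib matrix_mul_assoc)
  from has_vector_derivative_zero_eq[OF this, of t 0]
  have "g (- t) ** (W t ** g t) = Y" by (simp add: W_def)
  then have "g t ** Y = g t ** (g (- t) ** (W t ** g t))" by simp
  then show ?thesis by (simp add: matrix_mul_assoc W_def)
qed

text \<open>Puts \<open>[\<xi>, Y]\<close> into the Lie algebra of the group, as a conjugate of \<open>Y\<close>.\<close>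

lemma Z_eq: "Z = g (pi / 2) ** Y ** g (- (pi / 2))"
  using g_rotates_Y[of "pi / 2"] by simp

text \<open>A rotation that fixes \<open>Y\<close> is trivial, because \<open>Y\<close> and \<open>[\<xi>, Y]\<close> are linearly independent.\<close>

lemma sin_eq_0_if_commute:
  assumes "g (2 * t) ** Y = Y ** g (2 * t)"
  shows "sin t = 0"
proof -
  define c s where "c = cos (2 * t) - 1" and "s = sin (2 * t)"
  have 1: "c *\<^sub>R Y + s *\<^sub>R Z = 0"
    using assms unfolding g_rotates_Y g_cancel by (simp add: c_def s_def algebra_simps)
  have "bracket \<xi> (c *\<^sub>R Y + s *\<^sub>R Z) = 0" unfolding 1 by simp
  then have 2: "c *\<^sub>R Z - s *\<^sub>R Y = 0"
    by (simp add: Y_bracket)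
  have "(c\<^sup>2 + s\<^sup>2) *\<^sub>R Y = c *\<^sub>R (c *\<^sub>R Y + s *\<^sub>R Z) - s *\<^sub>R (c *\<^sub>R Z - s *\<^sub>R Y)"
    by (simp add: algebra_simps power2_eq_square)
  then have "c\<^sup>2 + s\<^sup>2 = 0" using 1 2 Y_nz by simp
  then have "cos (2 * t) = 1" by (simp add: c_def sum_power2_eq_zero_iff)
  then show ?thesis by (simp add: cos_double_sin)
qed

lemma invol_g: "invol S (g t) = g (- t)"
  using mexp_homomorphism[OF invol_linear invol_mult invol_one, of "t *\<^sub>R \<xi>"]
  by (simp add: g_def linear_scale[OF invol_linear] xi_invol)

text \<open>If \<open>g t\<close> is fixed by the involution, then \<open>g t = g (- t)\<close>, so \<open>g (2 * t) = 1\<close>.\<close>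

lemma sin_eq_0_if_isot:
  assumes "g t \<in> isot S"
  shows "sin t = 0"
proof (rule sin_eq_0_if_commute)
  have "g t = g (- t)" using isot_fixed[OF assms] by (simp add: invol_g)
  then have "g (2 * t) = mat 1" using g_add[of t t] g_inv(1)[of t] by simp
  then show "g (2 * t) ** Y = Y ** g (2 * t)" by simp
qed

text \<open>In the form needed for \<open>Ad_orbit\<close>, which is written with \<open>matrix_inv\<close>.\<close>

lemma isot_inv':
  assumes "A \<in> isot S"
  shows "matrix_inv A \<in> isot S" "A ** matrix_inv A = mat 1" "matrix_inv A ** A = mat 1"
proof -
  obtain B where B: "B \<in> isot S" "A ** B = mat 1" using isot_inv[OF assms] by auto
  then show "matrix_inv A \<in> isot S" and inv: "A ** matrix_inv A = mat 1"
    by (simp_all add: matrix_inv_eqI)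
  from inv show "matrix_inv A ** A = mat 1" by (rule matrix_left_right_inverse[THEN iffD1])
qed

lemma point_mult_subset: "k \<in> isot S \<Longrightarrow> point S (A ** k) \<subseteq> point S A"
  unfolding point_def using isot_mult by (auto simp flip: matrix_mul_assoc)

lemma point_eq_iff: "point S A = point S B \<longleftrightarrow> (\<exists>k\<in>isot S. A = B ** k)"
proof
  assume "point S A = point S B"
  moreover have "A \<in> point S A" using isot_one by (force simp: point_def)
  ultimately show "\<exists>k\<in>isot S. A = B ** k" by (auto simp: point_def)
next
  assume "\<exists>k\<in>isot S. A = B ** k"
  then obtain k where k: "k \<in> isot S" "A = B ** k" by auto
  have "B = A ** matrix_inv k"
    using isot_inv'[OF k(1)] by (simp add: k(2) flip: matrix_mul_assoc)
  then show "point S A = point S B"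
    using point_mult_subset[OF k(1), of B] point_mult_subset[OF isot_inv'(1)[OF k(1)], of A]
    by (simp add: k(2))
qed

lemma point_g_eq_iff: "point S (A ** g t) = point S (g t) \<longleftrightarrow> g (- t) ** A ** g t \<in> isot S"
proof -
  have "A ** g t = g t ** k \<longleftrightarrow> g (- t) ** A ** g t = k" for k
    using g_cancel(1)[of "- t" "A ** g t" "g t ** k"] by (simp add: matrix_mul_assoc)
  then show ?thesis by (auto simp: point_eq_iff)
qed

lemma point_mult_isot: "k \<in> isot S \<Longrightarrow> point S (A ** k) = point S A"
  by (auto simp: point_eq_iff)

lemma half_turns: "A \<in> isot S \<Longrightarrow> g (- (real j * pi)) ** A ** g (real j * pi) \<in> isot S"
proof (induction j)
  case (Suc j)
  have "g (- (real (Suc j) * pi)) = g (- pi) ** g (- (real j * pi))"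
    "g (real (Suc j) * pi) = g (real j * pi) ** g pi"
    by (simp_all add: algebra_simps flip: g_add)
  then show ?case
    using half_turn[OF Suc.IH[OF Suc.prems]] by (simp add: g_def matrix_mul_assoc)
qed simp

abbreviation isot0 :: "'m cmat set" where
  "isot0 \<equiv> connected_component_set (isot S) (mat 1)"

lemma isot0_subset: "isot0 \<subseteq> isot S"
  by (rule connected_component_subset)

lemma Y_isot0: "mexp (s *\<^sub>R Y) \<in> isot0" for s :: real
proof -
  have "continuous_on UNIV (\<lambda>s::real. mexp (s *\<^sub>R Y))"
    unfolding continuous_on_eq_continuous_within
    using has_vector_derivative_continuous[OF mexp_has_vector_derivative] by blast
  then have "connected (range (\<lambda>s::real. mexp (s *\<^sub>R Y)))"
    by (intro connected_continuous_image) auto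
  moreover have "mat 1 \<in> range (\<lambda>s::real. mexp (s *\<^sub>R Y))"
    by (rule range_eqI[of _ _ 0]) simp
  ultimately show ?thesis
    unfolding mem_Collect_eq connected_component_def
    using Y_isot by (intro exI[of _ "range (\<lambda>s::real. mexp (s *\<^sub>R Y))"]) auto
qed

text \<open>The involution fixes both \<open>k\<close> and \<open>g (- t) ** k ** g t\<close>, and it maps the latter to
  \<open>g t ** k ** g (- t)\<close>; thus \<open>k\<close> commutes with \<open>g (2 * t)\<close>. Apply this to the one-parameter group
  of \<open>Y\<close> and differentiate.\<close>

lemma sin_eq_0_if_conj_isot:
  assumes "\<And>k. k \<in> isot0 \<Longrightarrow> g (- t) ** k ** g t \<in> isot S"
  shows "sin t = 0"
proof (rule sin_eq_0_if_commute)
  let ?E = "\<lambda>s::real. mexp (s *\<^sub>R Y)"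
  have eq: "g (2 * t) ** ?E s = ?E s ** g (2 * t)" for s
  proof -
    have "invol S (?E s) = ?E s" using Y_isot by (rule isot_fixed)
    then have "g t ** ?E s ** g (- t) = g (- t) ** ?E s ** g t"
      using isot_fixed[OF assms[OF Y_isot0[of s]]] by (simp add: invol_mult invol_g)
    then have "g t ** (g t ** ?E s ** g (- t)) ** g t = g t ** (g (- t) ** ?E s ** g t) ** g t"
      by simp
    then show ?thesis
      using g_add[of t t] by (simp add: matrix_mul_assoc)
  qed
  have "((\<lambda>s. ?E s ** g (2 * t)) has_vector_derivative g (2 * t) ** (Y ** ?E 0)) (at 0)"
    unfolding eq[symmetric]
    by (rule bounded_linear.has_vector_derivative
        [OF bounded_bilinear.bounded_linear_right[OF bounded_bilinear_cmat] mexp_has_vector_derivative])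
  moreover have "((\<lambda>s. ?E s ** g (2 * t)) has_vector_derivative (Y ** ?E 0) ** g (2 * t)) (at 0)"
    by (rule bounded_linear.has_vector_derivative
        [OF bounded_bilinear.bounded_linear_left[OF bounded_bilinear_cmat] mexp_has_vector_derivative])
  ultimately have "g (2 * t) ** (Y ** ?E 0) = (Y ** ?E 0) ** g (2 * t)"
    by (rule vector_derivative_unique_at)
  then show "g (2 * t) ** Y = Y ** g (2 * t)" by simp
qed

text \<open>The factor \<open>matrix_inv k\<close> of the conjugate of \<open>g t\<close> is absorbed by the coset.\<close>

lemma spindle_eq: "spindle S \<xi> t = (\<lambda>k. point S (k ** g t)) ` isot0"
proof -
  have "Exp S (t *\<^sub>R (k ** \<xi> ** matrix_inv k)) = point S (k ** g t)" if "k \<in> isot0" for k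
  proof -
    have k: "k \<in> isot S" using that isot0_subset by auto
    have "mexp (t *\<^sub>R (k ** \<xi> ** matrix_inv k)) = k ** g t ** matrix_inv k"
      using mexp_conj[OF isot_inv'(3)[OF k], of "t *\<^sub>R \<xi>"] by (simp add: g_def)
    then show ?thesis by (simp add: Exp_def point_mult_isot isot_inv'[OF k])
  qed
  then show ?thesis
    unfolding spindle_def Ad_orbit_def Setcompr_eq_image image_image by (intro image_cong) auto
qed

lemma knot_iff:
  assumes "t \<ge> 0"
  shows "is_singleton (spindle S \<xi> t) \<longleftrightarrow> sin t = 0"
proof
  assume "is_singleton (spindle S \<xi> t)"
  then obtain x where x: "(\<lambda>k. point S (k ** g t)) ` isot0 = {x}"
    unfolding spindle_eq by (auto elim: is_singletonE)
  have "mat 1 \<in> isot0" using isot_one by simp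
  with x have "point S (mat 1 ** g t) = x" by blast
  with x have "point S (k ** g t) = point S (g t)" if "k \<in> isot0" for k using that by auto
  then show "sin t = 0" by (intro sin_eq_0_if_conj_isot) (simp add: point_g_eq_iff)
next
  assume "sin t = 0"
  then obtain i :: int where i: "t = of_int i * pi" using sin_zero_iff_int2 by blast
  with assms have "i \<ge> 0" by (simp add: int_pi)
  then have t: "t = real (nat i) * pi" using i by simp
  have "point S (k ** g t) = point S (g t)" if "k \<in> isot0" for k
    using that isot0_subset half_turns[of k "nat i"] unfolding point_g_eq_iff t by auto
  then have "spindle S \<xi> t = (\<lambda>k. point S (g t)) ` isot0"
    unfolding spindle_eq by (intro image_cong refl)
  also have "\<dots> = {point S (g t)}"
    using isot_one by (intro image_constant[of "mat 1"]) simp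
  finally have "spindle S \<xi> t = {point S (g t)}" .
  then show "is_singleton (spindle S \<xi> t)" by simp
qed

lemma geodesic_eq: "geodesic S \<xi> t = point S (g t)"
  by (simp add: geodesic_def Exp_def g_def)

lemma geodesic_base_iff: "geodesic S \<xi> t = point S (mat 1) \<longleftrightarrow> g t \<in> isot S"
  by (auto simp: geodesic_eq point_eq_iff)

lemma g_m_isot: "g (real m * pi) \<in> isot S"
  using m_first[of m] m_pos by (simp add: g_def)

lemma period_eq: "period S \<xi> = real m * pi"
proof -
  have first: "g t \<notin> isot S" if "0 < t" "t < real m * pi" for t
  proof
    assume t: "g t \<in> isot S"
    then obtain i :: int where i: "t = of_int i * pi"
      using sin_eq_0_if_isot sin_zero_iff_int2 by blast
    with that have "0 < i" "i < int m" by (simp_all add: int_pi)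
    then show False
      using m_first[of "nat i"] t i by (auto simp: g_def)
  qed
  have "point S (mat 1) \<in> geodesic S \<xi> ` {0<..<T} \<longleftrightarrow> (\<exists>t\<in>{0<..<T}. g t \<in> isot S)" for T
    unfolding image_iff eq_commute[of "point S (mat 1)"] geodesic_base_iff ..
  then have "period S \<xi> = (THE T. T > 0 \<and> g T \<in> isot S \<and> (\<forall>t\<in>{0<..<T}. g t \<notin> isot S))"
    by (simp add: period_def geodesic_base_iff)
  also have "\<dots> = real m * pi"
  proof (rule the_equality)
    show "real m * pi > 0 \<and> g (real m * pi) \<in> isot S \<and> (\<forall>t\<in>{0<..<real m * pi}. g t \<notin> isot S)"
      using m_pos g_m_isot first by simp
  next
    fix T assume T: "T > 0 \<and> g T \<in> isot S \<and> (\<forall>t\<in>{0<..<T}. g t \<notin> isot S)"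
    then have "\<not> T < real m * pi" using first by blast
    moreover have "\<not> real m * pi < T"
    proof
      assume "real m * pi < T"
      then have "real m * pi \<in> {0<..<T}" using m_pos by simp
      with T g_m_isot show False by blast
    qed
    ultimately show "T = real m * pi" by linarith
  qed
  finally show ?thesis .
qed

theorem spindle_number_eq: "spindle_number S \<xi> = m"
proof -
  have "{t \<in> {0..<real m * pi}. is_singleton (spindle S \<xi> t)} = (\<lambda>j. real j * pi) ` {..<m}"
  proof (intro equalityI subsetI)
    fix t assume t: "t \<in> {t \<in> {0..<real m * pi}. is_singleton (spindle S \<xi> t)}"
    then obtain i :: int where i: "t = of_int i * pi"
      using knot_iff[of t] sin_zero_iff_int2 by auto
    with t have "0 \<le> i" "i < int m" by (simp_all add: int_pi)
    then show "t \<in> (\<lambda>j. real j * pi) ` {..<m}"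
      using i by (intro image_eqI[of _ _ "nat i"]) auto
  qed (auto simp: knot_iff)
  then show ?thesis
    by (simp add: spindle_number_def period_eq card_image inj_on_def)
qed

lemma grp_conj: "A \<in> grp S \<Longrightarrow> g s ** A ** g t \<in> grp S"
  using grp_mult xi_grp by (simp add: g_def)

text \<open>The vector \<open>[\<xi>, Y] + iY\<close> has the eigenvalue \<open>\<i>\<close>, and 1 in the set of the \<open>\<nu>\<close> makes its greatest
  common divisor 1.\<close>

theorem extrinsically_symmetric: "extrinsically_symmetric_type S \<xi>"
proof -
  let ?ev = "ad_eigenvalues (lie_algebra (grp S)) \<xi>"
  have xi: "\<xi> \<in> lie_p S" by (simp add: lie_p_def lie_algebra_def xi_grp xi_invol)
  have xi_nz: "\<xi> \<noteq> 0" using Y_bracket Y_nz by (auto simp: bracket_def)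
  have "geodesic S \<xi> (t + real m * pi) = geodesic S \<xi> t" for t
    using g_m_isot by (simp add: geodesic_eq g_add point_mult_isot)
  then have closed: "closed_geodesic S \<xi>"
    unfolding closed_geodesic_def using m_pos by (intro exI[of _ "real m * pi"]) simp
  have sub: "?ev \<subseteq> {0, \<i>, - \<i>}"
    unfolding ad_eigenvalues_def using eigenvalue_cases[OF linear_bracket] cubic by blast
  have Y: "Y \<in> lie_algebra (grp S)" by (simp add: lie_algebra_def Y_grp)
  have "mexp (t *\<^sub>R Z) = g (pi / 2) ** mexp (t *\<^sub>R Y) ** g (- (pi / 2))" for t
    using mexp_conj[of "g (- (pi / 2))" "g (pi / 2)" "t *\<^sub>R Y"] by (simp add: Z_eq)
  then have Z: "Z \<in> lie_algebra (grp S)" by (simp add: lie_algebra_def grp_conj Y_grp)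
  have i: "\<i> \<in> ?ev"
    unfolding ad_eigenvalues_def mem_Collect_eq
    by (rule bexI[OF bexI[OF _ Y] Z]) (simp add: Y_nz Y_bracket)
  define N where "N = {\<nu>::int. \<i> * of_int \<nu> \<in> ?ev}"
  have "?ev = (\<lambda>\<nu>. \<i> * of_int \<nu>) ` N"
  proof -
    have "\<exists>\<nu>::int. \<mu> = \<i> * of_int \<nu>" if "\<mu> \<in> {0, \<i>, - \<i>}" for \<mu> :: complex
      using that by (auto intro: exI[of _ 0] exI[of _ 1] exI[of _ "- 1"])
    then have "\<exists>\<nu>::int. \<mu> = \<i> * of_int \<nu>" if "\<mu> \<in> ?ev" for \<mu>
      using sub that by (meson subsetD)
    then show ?thesis by (fastforce simp: N_def)
  qed
  moreover have "Gcd N = 1"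
  proof -
    have "1 \<in> N" using i by (simp add: N_def)
    then have "Gcd N dvd 1" by (rule Gcd_dvd)
    then show ?thesis by simp
  qed
  ultimately show ?thesis
    unfolding extrinsically_symmetric_type_def canonical_def
    by (intro conjI exI[of _ N] ballI xi xi_nz closed cubic)
qed

end

section \<open>Block matrices\<close>

lemma block_eq_iff:
  "block A B C D = block A' B' C' D' \<longleftrightarrow> A = A' \<and> B = B' \<and> C = C' \<and> D = D'"
proof
  assume "block A B C D = block A' B' C' D'"
  then have eq: "block A B C D $ i $ j = block A' B' C' D' $ i $ j" for i j by simp
  have "A $ r $ c = A' $ r $ c" "B $ r $ d = B' $ r $ d" "C $ s $ c = C' $ s $ c"
      "D $ s $ d = D' $ s $ d" for r c s d
    using eq[of "Inl r" "Inl c"] eq[of "Inl r" "Inr d"] eq[of "Inr s" "Inl c"] eq[of "Inr s" "Inr d"]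
    by (simp_all add: block_def)
  then show "A = A' \<and> B = B' \<and> C = C' \<and> D = D'" by (simp add: vec_eq_iff)
qed simp

lemma cmat_sum_type_eqI:
  fixes M N :: "('p::finite + 'q::finite) cmat"
  assumes "\<And>r c. M $ Inl r $ Inl c = N $ Inl r $ Inl c" "\<And>r c. M $ Inl r $ Inr c = N $ Inl r $ Inr c"
    "\<And>r c. M $ Inr r $ Inl c = N $ Inr r $ Inl c" "\<And>r c. M $ Inr r $ Inr c = N $ Inr r $ Inr c"
  shows "M = N"
  unfolding vec_eq_iff
proof (intro allI)
  show "M $ i $ j = N $ i $ j" for i j
    by (cases i; cases j) (simp_all add: assms)
qed

lemma sum_UNIV_sum_type:
  fixes f :: "'p::finite + 'q::finite \<Rightarrow> 'a::comm_monoid_add"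
  shows "sum f UNIV = (\<Sum>i\<in>UNIV. f (Inl i)) + (\<Sum>j\<in>UNIV. f (Inr j))"
  using sum.Plus[of "UNIV :: 'p set" "UNIV :: 'q set" f] by (simp add: o_def)

lemma block_mult:
  fixes A :: "complex^('p::finite)^'p" and D :: "complex^('q::finite)^'q"
  shows "block A B C D ** block A' B' C' D' =
    block (A ** A' + B ** C') (A ** B' + B ** D') (C ** A' + D ** C') (C ** B' + D ** D')"
  by (rule cmat_sum_type_eqI) (simp_all add: block_def matrix_matrix_mult_def sum_UNIV_sum_type)

lemma block_simps:
  fixes A :: "complex^('p::finite)^'p" and D :: "complex^('q::finite)^'q"
  shows "block A B C D + block A' B' C' D' = block (A + A') (B + B') (C + C') (D + D')"
    "block A B C D - block A' B' C' D' = block (A - A') (B - B') (C - C') (D - D')"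
    "- block A B C D = block (- A) (- B) (- C) (- D)"
    "x *\<^sub>R block A B C D = block (x *\<^sub>R A) (x *\<^sub>R B) (x *\<^sub>R C) (x *\<^sub>R D)"
    "transpose (block A B C D) = block (transpose A) (transpose C) (transpose B) (transpose D)"
    "cnj_mat (block A 0 0 D) = block (cnj_mat A) 0 0 (cnj_mat D)"
  by (rule cmat_sum_type_eqI; simp add: block_def transpose_def cnj_mat_def)+

lemma cnj_mat_block:
  fixes A B C D :: "('n::finite) cmat"
  shows "cnj_mat (block A B C D) = block (cnj_mat A) (cnj_mat B) (cnj_mat C) (cnj_mat D)"
  by (rule cmat_sum_type_eqI; simp add: block_def cnj_mat_def)+

lemma mat_eq_block: "(mat c :: ('p::finite + 'q::finite) cmat) = block (mat c) 0 0 (mat c)"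
  by (rule cmat_sum_type_eqI; simp add: block_def mat_def)+

lemma zero_eq_block: "(0 :: ('p::finite + 'q::finite) cmat) = block 0 0 0 0"
  by (rule cmat_sum_type_eqI; simp add: block_def)+

lemma mat_mult_nth: "(mat a ** A) $ i $ j = a * A $ i $ j" "(A ** mat a) $ i $ j = a * A $ i $ j"
  for A :: "('n::finite) cmat"
  by (simp_all add: mat_def matrix_matrix_mult_def mult_delta_left mult_delta_right)

lemma mat_simps [simp]:
  "(mat a :: ('n::finite) cmat) ** mat b = mat (a * b)" "- (mat a :: 'n cmat) = mat (- a)"
  "x *\<^sub>R (mat a :: 'n cmat) = mat (of_real x * a)" "(mat a :: 'n cmat) + mat b = mat (a + b)"
  "cnj_mat (mat a :: 'n cmat) = mat (cnj a)"
  "mat a - (mat b :: 'n cmat) = mat (a - b)" "mat 0 = (0 :: 'n cmat)"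
  by (simp_all add: vec_eq_iff mat_mult_nth)
    (simp_all add: mat_def cnj_mat_def scaleR_conv_of_real[where 'a = complex])

lemma mat_eq_iff [simp]: "(mat a :: ('n::finite) cmat) = mat b \<longleftrightarrow> a = b"
  by (auto simp: mat_def vec_eq_iff)

lemma mat_eq_0_iff [simp]: "(mat a :: ('n::finite) cmat) = 0 \<longleftrightarrow> a = 0"
  by (auto simp: mat_def vec_eq_iff)

lemma mat_of_real_mult: "mat (of_real c) ** A = c *\<^sub>R (A :: ('n::finite) cmat)"
  by (simp add: vec_eq_iff mat_mult_nth scaleR_conv_of_real[where 'a = complex])

lemma mat_minus_one_mult [simp]:
  "mat (- 1) ** A = - A" "A ** mat (- 1) = - (A :: ('n::finite) cmat)"
  by (simp_all add: vec_eq_iff mat_mult_nth)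

lemma mat_mult_commute: "A ** mat a = mat a ** (A :: ('n::finite) cmat)"
  by (simp add: vec_eq_iff mat_mult_nth)

lemma mat_mult_assoc [simp]: "mat a ** (mat b ** A) = mat (a * b) ** (A :: ('n::finite) cmat)"
  by (simp add: matrix_mul_assoc)

lemma J_simps [simp]: "J ** J = - mat 1" "transpose J = - J" "cnj_mat J = J"
  by (simp_all add: J_def block_mult mat_eq_block block_simps cnj_mat_block)

lemma matrix_inv_J [simp]: "matrix_inv J = - J"
  by (rule matrix_inv_eqI) simp

lemma diag_sign_simps [simp]:
  "diag_sign ** diag_sign = mat 1" "transpose diag_sign = diag_sign" "cnj_mat diag_sign = diag_sign"
  by (simp_all add: diag_sign_def block_mult mat_eq_block block_simps)

lemma matrix_inv_diag_sign [simp]: "matrix_inv diag_sign = diag_sign"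
  by (rule matrix_inv_eqI) simp

text \<open>Termwise in the exponential series, which is split into the series of the two diagonal blocks.\<close>

lemma mexp_block:
  fixes A :: "('p::finite) cmat" and B :: "('q::finite) cmat"
  shows "mexp (block A 0 0 B) = block (mexp A) 0 0 (mexp B)"
proof -
  let ?\<phi> = "\<lambda>A::'p cmat. block A 0 0 (0 :: 'q cmat)" and ?\<psi> = "\<lambda>B::'q cmat. block (0 :: 'p cmat) 0 0 B"
  have lin: "bounded_linear ?\<phi>" "bounded_linear ?\<psi>"
    unfolding linear_conv_bounded_linear[symmetric]
    by (intro linearI; simp add: block_simps)+
  have pow: "mpow (block A 0 0 B) k = ?\<phi> (mpow A k) + ?\<psi> (mpow B k)" for k
    by (induction k) (simp_all add: block_mult mat_eq_block block_simps)
  have "(\<lambda>k. ?\<phi> ((1 / fact k) *\<^sub>R mpow A k) + ?\<psi> ((1 / fact k) *\<^sub>R mpow B k)) sums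
      (?\<phi> (mexp A) + ?\<psi> (mexp B))"
    by (rule sums_add[OF bounded_linear.sums[OF lin(1) mexp_sums] bounded_linear.sums[OF lin(2) mexp_sums]])
  then have "(\<lambda>k. (1 / fact k) *\<^sub>R mpow (block A 0 0 B) k) sums block (mexp A) 0 0 (mexp B)"
    by (simp add: pow block_simps)
  then show ?thesis by (rule sums_unique2[OF mexp_sums])
qed


section \<open>The classical groups and the symmetric pairs\<close>

lemma U_iff: "A \<in> U \<longleftrightarrow> transpose (cnj_mat A) ** A = mat 1"
  by (simp add: U_def)

lemma mat_1_in [simp]: "mat 1 \<in> U" "mat 1 \<in> SU" "mat 1 \<in> SO" "mat 1 \<in> Sp"
  using mexp_in_U[of 0] mexp_in_SO[of 0] SO_subset_SU mexp_in_Sp[of 0] by auto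

lemma U_mult: 
  assumes "A \<in> U" "B \<in> U" shows "A ** B \<in> U"
proof -
  have "transpose (cnj_mat (A ** B)) ** (A ** B) =
      transpose (cnj_mat B) ** (transpose (cnj_mat A) ** A) ** B"
    by (simp add: cnj_mat_mult matrix_transpose_mul matrix_mul_assoc)
  with assms show ?thesis by (simp add: U_iff)
qed

lemma SU_mult: "A \<in> SU \<Longrightarrow> B \<in> SU \<Longrightarrow> A ** B \<in> SU"
  by (simp add: SU_def U_mult det_mul)

lemma SU_imp_U: "A \<in> SU \<Longrightarrow> A \<in> U"
  by (simp add: SU_def)

lemma SO_iff: "A \<in> SO \<longleftrightarrow> A \<in> SU \<and> cnj_mat A = A"
  unfolding SO_def SU_def U_def cnj_mat_eq_iff_real[symmetric] by auto

lemma SO_mult: "A \<in> SO \<Longrightarrow> B \<in> SO \<Longrightarrow> A ** B \<in> SO"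
  by (simp add: SO_iff SU_mult cnj_mat_mult)

lemma U_inverse:
  assumes "A \<in> U"
  shows "A ** transpose (cnj_mat A) = mat 1" "transpose (cnj_mat A) \<in> U"
proof -
  show *: "A ** transpose (cnj_mat A) = mat 1"
    using assms unfolding U_iff by (rule matrix_left_right_inverse[THEN iffD1])
  show "transpose (cnj_mat A) \<in> U"
    using * by (simp add: U_iff)
qed

lemma SU_inverse:
  assumes "A \<in> SU"
  shows "transpose (cnj_mat A) \<in> SU"
proof -
  have "det (transpose (cnj_mat A) ** A) = 1" using assms by (simp add: SU_def U_iff)
  with assms show ?thesis by (simp add: SU_def U_inverse det_mul)
qed

lemma SO_inverse:
  assumes "A \<in> SO"
  shows "transpose A \<in> SO" "A ** transpose A = mat 1"
  using assms SU_inverse[of A] U_inverse[of A] by (auto simp: SO_iff SU_def)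

text \<open>For unitary \<open>A\<close> the transpose is the inverse of \<open>cnj_mat A\<close>, which makes the condition linear
  in \<open>A\<close> and shows that \<open>Sp\<close> is the fixed set, within \<open>U\<close>, of the involution of type A II.\<close>

lemma Sp_iff: "A \<in> Sp \<longleftrightarrow> A \<in> U \<and> J ** A = cnj_mat A ** J"
proof (cases "A \<in> U")
  case True
  have inv: "cnj_mat A ** transpose A = mat 1" "transpose A ** cnj_mat A = mat 1"
  proof -
    show *: "cnj_mat A ** transpose A = mat 1"
      using arg_cong[OF U_inverse(1)[OF True], of cnj_mat] by (simp add: cnj_mat_mult)
    show "transpose A ** cnj_mat A = mat 1"
      by (rule matrix_left_right_inverse[THEN iffD1, OF *])
  qed
  have "transpose A ** J ** A = J \<longleftrightarrow> J ** A = cnj_mat A ** J"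
  proof
    assume "transpose A ** J ** A = J"
    then have "cnj_mat A ** J = cnj_mat A ** (transpose A ** J ** A)" by simp
    also have "\<dots> = (cnj_mat A ** transpose A) ** J ** A" by (simp add: matrix_mul_assoc)
    finally have "cnj_mat A ** J = (cnj_mat A ** transpose A) ** J ** A" .
    then show "J ** A = cnj_mat A ** J" by (simp add: inv)
  next
    assume "J ** A = cnj_mat A ** J"
    then have "transpose A ** J ** A = (transpose A ** cnj_mat A) ** J"
      by (simp flip: matrix_mul_assoc)
    then show "transpose A ** J ** A = J" by (simp add: inv)
  qed
  with True show ?thesis by (simp add: Sp_def)
qed (simp add: Sp_def)

lemma Sp_mult:
  assumes "A \<in> Sp" "B \<in> Sp" shows "A ** B \<in> Sp"
proof -
  have "J ** (A ** B) = cnj_mat A ** (J ** B)"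
    using assms(1) by (simp add: Sp_iff matrix_mul_assoc)
  also have "\<dots> = cnj_mat (A ** B) ** J"
    using assms(2) by (simp add: Sp_iff cnj_mat_mult) (simp add: matrix_mul_assoc)
  finally show ?thesis using assms by (simp add: Sp_iff U_mult)
qed

lemma commute_inverse:
  fixes A B P :: "('m::finite) cmat"
  assumes "P ** A = A' ** P" "A ** B = mat 1" "B' ** A' = mat 1"
  shows "P ** B = B' ** P"
proof -
  have "P ** B = B' ** (A' ** P) ** B" using assms(3) by (simp add: matrix_mul_assoc)
  also have "\<dots> = B' ** P ** (A ** B)" by (simp add: matrix_mul_assoc flip: assms(1))
  finally show ?thesis by (simp add: assms(2))
qed

lemma Sp_inverse:
  assumes "A \<in> Sp"
  shows "transpose (cnj_mat A) \<in> Sp"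
proof -
  have A: "A \<in> U" using assms by (simp add: Sp_iff)
  have inv: "cnj_mat (transpose (cnj_mat A)) ** cnj_mat A = mat 1"
    using arg_cong[OF A[unfolded U_iff], of cnj_mat] by (simp add: cnj_mat_mult)
  have "J ** A = cnj_mat A ** J" using assms by (simp add: Sp_iff)
  then have "J ** transpose (cnj_mat A) = cnj_mat (transpose (cnj_mat A)) ** J"
    using U_inverse(1)[OF A] inv by (rule commute_inverse)
  then show ?thesis using A by (simp add: Sp_iff U_inverse)
qed

lemma conj_fixed_iff:
  fixes P Q :: "('m::finite) cmat"
  assumes "Q ** P = mat 1"
  shows "P ** A ** Q = B \<longleftrightarrow> P ** A = B ** P"
proof -
  have "P ** Q = mat 1" by (rule matrix_left_right_inverse[THEN iffD1, OF assms])
  show ?thesis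
  proof
    assume "P ** A ** Q = B"
    then have "B ** P = P ** A ** (Q ** P)" by (simp add: matrix_mul_assoc)
    then show "P ** A = B ** P" by (simp add: assms)
  next
    assume "P ** A = B ** P"
    then show "P ** A ** Q = B" using \<open>P ** Q = mat 1\<close> by (simp flip: matrix_mul_assoc)
  qed
qed

section \<open>Elements with square \<open>- 1/4\<close>\<close>

lemma mexp_half_imaginary:
  fixes \<xi> :: "('m::finite) cmat"
  assumes "\<xi> ** \<xi> = mat (- 1 / 4)"
  shows "mexp (t *\<^sub>R \<xi>) = mat (of_real (cos (t / 2))) + (2 * sin (t / 2)) *\<^sub>R \<xi>"
proof -
  let ?F = "\<lambda>t. cos (t / 2) *\<^sub>R (mat 1 :: 'm cmat) + (2 * sin (t / 2)) *\<^sub>R \<xi>"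
  have "(?F has_vector_derivative \<xi> ** ?F t) (at t)" for t
  proof (rule has_vector_derivative_eq_rhs)
    show "(?F has_vector_derivative (- sin (t / 2) / 2) *\<^sub>R mat 1 + cos (t / 2) *\<^sub>R \<xi>) (at t)"
      by (auto intro!: derivative_eq_intros simp del: mat_simps)
    have "(2 * sin (t / 2)) *\<^sub>R (mat (- 1 / 4) :: 'm cmat) = (- sin (t / 2) / 2) *\<^sub>R mat 1"
      by simp
    then show "(- sin (t / 2) / 2) *\<^sub>R mat 1 + cos (t / 2) *\<^sub>R \<xi> = \<xi> ** ?F t"
      by (simp add: cmat_distrib assms del: mat_simps)
  qed
  from mexp_ode_unique[of ?F, OF this, of t] show ?thesis by simp
qed

text \<open>The eigenvalues of \<open>\<xi>\<close> are \<open>\<plusminus>\<i>/2\<close>, so their differences are \<open>0\<close> and \<open>\<plusminus>\<i>\<close>.\<close>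

lemma bracket_cubic_half_imaginary:
  fixes \<xi> :: "('m::finite) cmat"
  assumes "\<xi> ** \<xi> = mat (- 1 / 4)"
  shows "bracket \<xi> (bracket \<xi> (bracket \<xi> X)) = - bracket \<xi> X"
proof -
  have sq: "\<xi> ** (\<xi> ** A) = (- 1 / 4) *\<^sub>R A" "A ** \<xi> ** \<xi> = (- 1 / 4) *\<^sub>R A" for A :: "'m cmat"
    using mat_of_real_mult[of "- 1 / 4" A]
    by (simp_all add: matrix_mul_assoc assms) (simp add: assms mat_mult_commute flip: matrix_mul_assoc)
  have twice: "bracket \<xi> (bracket \<xi> A) = (- 1 / 2) *\<^sub>R A - 2 *\<^sub>R (\<xi> ** A ** \<xi>)" for A
  proof -
    have "bracket \<xi> (bracket \<xi> A) = \<xi> ** (\<xi> ** A) - \<xi> ** A ** \<xi> - (\<xi> ** A ** \<xi> - A ** \<xi> ** \<xi>)"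
      by (simp add: bracket_def cmat_distrib matrix_mul_assoc)
    then show ?thesis by (simp add: sq scaleR_2 flip: scaleR_add_left)
  qed
  have "\<xi> ** bracket \<xi> X ** \<xi> = \<xi> ** (\<xi> ** X) ** \<xi> - \<xi> ** (X ** \<xi> ** \<xi>)"
    by (simp add: bracket_def cmat_distrib matrix_mul_assoc)
  also have "\<dots> = (1 / 4) *\<^sub>R bracket \<xi> X"
    by (simp add: sq bracket_def scaleR_diff_right)
  finally show ?thesis
    unfolding twice[of "bracket \<xi> X"] by (simp flip: scaleR_add_left)
qed

text \<open>Here \<open>g (j * pi)\<close> for \<open>j = 1, 2, 3, 4\<close> is \<open>2 \<xi>\<close>, \<open>- 1\<close>, \<open>- 2 \<xi>\<close> and \<open>1\<close>. The involution negates \<open>\<xi>\<close>, so the odd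
  multiples are never in the isotropy group. An element \<open>Y\<close> that anticommutes with \<open>\<xi>\<close> satisfies
  \<open>[\<xi>, [\<xi>, Y]] = 4 \<xi> ** \<xi> ** Y = - Y\<close>.\<close>

lemma (in symmetric_pair) spindle_data_half_imaginary:
  assumes sq: "\<xi> ** \<xi> = mat (- 1 / 4)"
    and anti: "Y ** \<xi> = - (\<xi> ** Y)" and "Y \<noteq> 0"
    and "\<And>t::real. mexp (t *\<^sub>R \<xi>) \<in> grp S" "invol S \<xi> = - \<xi>"
    and "\<And>t::real. mexp (t *\<^sub>R Y) \<in> grp S" "\<And>t::real. mexp (t *\<^sub>R Y) \<in> isot S"
    and half: "\<And>A. A \<in> isot S \<Longrightarrow> (- (2 *\<^sub>R \<xi>)) ** A ** (2 *\<^sub>R \<xi>) \<in> isot S"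
  shows "spindle_data S \<xi> Y (if mat (- 1) \<in> isot S then 2 else 4)"
proof unfold_locales
  note exp = mexp_half_imaginary[OF sq]
  have notin: "c *\<^sub>R \<xi> \<notin> isot S" if "c \<noteq> 0" for c :: real
  proof
    assume "c *\<^sub>R \<xi> \<in> isot S"
    then have "invol S (c *\<^sub>R \<xi>) = c *\<^sub>R \<xi>" by (rule isot_fixed)
    then have "c *\<^sub>R \<xi> + c *\<^sub>R \<xi> = 0"
      by (simp add: linear_scale[OF invol_linear] assms neg_eq_iff_add_eq_0)
    then have "(c + c) *\<^sub>R \<xi> = 0" by (simp only: scaleR_add_left)
    then have "\<xi> = 0" using that by simp
    then show False using sq by simp
  qed
  show "mexp (- (pi *\<^sub>R \<xi>)) ** A ** mexp (pi *\<^sub>R \<xi>) \<in> isot S" if "A \<in> isot S" for A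
    using half[OF that] exp[of "- pi"] exp[of pi] by simp
  let ?m = "if mat (- 1) \<in> isot S then 2 else (4::nat)"
  show "mexp ((real j * pi) *\<^sub>R \<xi>) \<in> isot S \<longleftrightarrow> j = ?m" if j: "0 < j" "j \<le> ?m" for j
  proof -
    have "j \<in> {1, 2, 3, 4}" using j by (auto split: if_splits)
    moreover have "cos (3 * pi / 2) = 0" "sin (3 * pi / 2) = - 1"
      using cos_periodic_pi[of "pi / 2"] sin_periodic_pi[of "pi / 2"] by (simp_all add: add_divide_distrib[symmetric])
    moreover have "cos (4 * pi / 2) = 1" "sin (4 * pi / 2) = 0" by simp_all
    ultimately show ?thesis
      using j isot_one notin[of 2] notin[of "- 2"] exp[of "real j * pi"] by (auto split: if_splits)
  qed
  have "\<xi> ** (\<xi> ** Y) = (- 1 / 4) *\<^sub>R Y"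
    using mat_of_real_mult[of "- 1 / 4" Y] by (simp add: matrix_mul_assoc sq)
  moreover have "bracket \<xi> Y = 2 *\<^sub>R (\<xi> ** Y)"
    by (simp add: bracket_def anti scaleR_2)
  moreover have "bracket \<xi> (\<xi> ** Y) = 2 *\<^sub>R (\<xi> ** (\<xi> ** Y))"
    by (simp add: bracket_def anti scaleR_2 flip: matrix_mul_assoc)
  ultimately show "bracket \<xi> (bracket \<xi> Y) = - Y" by simp
qed (use assms bracket_cubic_half_imaginary[OF sq] in auto)

lemma isot_inverse_U:
  assumes "A \<in> U" "transpose (cnj_mat A) \<in> K"
  shows "\<exists>B\<in>K. A ** B = mat 1"
  using assms U_inverse(1) by blast

lemma symmetric_pair_AIII: "symmetric_pair (space_AIII :: ('n::finite + 'n) cmat sym_space)"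
proof (rule symmetric_pair.intro)
  let ?K = "isot space_AIII :: ('n + 'n) cmat set"
  fix A B :: "('n::finite + 'n) cmat"
  have dd: "diag_sign ** diag_sign = (mat 1 :: ('n + 'n) cmat)" by simp
  show "linear (invol space_AIII :: ('n + 'n) cmat \<Rightarrow> _)"
    "invol space_AIII (A ** B) = invol space_AIII A ** invol space_AIII B"
    "invol space_AIII (mat 1) = (mat 1 :: ('n + 'n) cmat)"
    using conj_involution[OF dd] by (simp_all add: space_AIII_def)
  show "A \<in> grp space_AIII \<Longrightarrow> B \<in> grp space_AIII \<Longrightarrow> A ** B \<in> grp space_AIII"
    by (simp add: space_AIII_def SU_mult)
  show "mat 1 \<in> ?K"
    by (simp add: space_AIII_def) (intro exI conjI, rule mat_eq_block, simp_all)
  show "A ** B \<in> ?K" if "A \<in> ?K" "B \<in> ?K"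
    using that by (auto simp: space_AIII_def SU_mult block_mult block_eq_iff intro: U_mult)
  show "invol space_AIII A = A" if "A \<in> ?K"
  proof -
    have "diag_sign ** A = A ** diag_sign"
      using that by (auto simp: space_AIII_def diag_sign_def block_mult)
    then show ?thesis using conj_fixed_iff[OF dd, of A A] by (simp add: space_AIII_def)
  qed
  show "\<exists>B\<in>?K. A ** B = mat 1" if "A \<in> ?K"
    using that
    by (intro isot_inverse_U)
      (auto simp: space_AIII_def SU_inverse block_simps block_eq_iff SU_imp_U intro: U_inverse(2))
qed

lemma symmetric_pair_BDI: "symmetric_pair (space_BDI :: ('p::finite + 'q::finite) cmat sym_space)"
proof (rule symmetric_pair.intro)
  let ?K = "isot space_BDI :: ('p + 'q) cmat set"
  fix A B :: "('p::finite + 'q::finite) cmat"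
  have dd: "diag_sign ** diag_sign = (mat 1 :: ('p + 'q) cmat)" by simp
  show "linear (invol space_BDI :: ('p + 'q) cmat \<Rightarrow> _)"
    "invol space_BDI (A ** B) = invol space_BDI A ** invol space_BDI B"
    "invol space_BDI (mat 1) = (mat 1 :: ('p + 'q) cmat)"
    using conj_involution[OF dd] by (simp_all add: space_BDI_def)
  show "A \<in> grp space_BDI \<Longrightarrow> B \<in> grp space_BDI \<Longrightarrow> A ** B \<in> grp space_BDI"
    by (simp add: space_BDI_def SO_mult)
  show "mat 1 \<in> ?K"
    by (simp add: space_BDI_def) (intro exI conjI, rule mat_eq_block, simp_all)
  show "A ** B \<in> ?K" if "A \<in> ?K" "B \<in> ?K"
    using that by (auto simp: space_BDI_def block_mult block_eq_iff intro: SO_mult)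
  show "invol space_BDI A = A" if "A \<in> ?K"
  proof -
    have "diag_sign ** A = A ** diag_sign"
      using that by (auto simp: space_BDI_def diag_sign_def block_mult)
    then show ?thesis using conj_fixed_iff[OF dd, of A A] by (simp add: space_BDI_def)
  qed
  show "\<exists>B\<in>?K. A ** B = mat 1" if A: "A \<in> ?K"
  proof -
    obtain C D where CD: "A = block C 0 0 D" "C \<in> SO" "D \<in> SO"
      using A by (auto simp: space_BDI_def)
    then have "A ** block (transpose C) 0 0 (transpose D) = mat 1"
      by (simp add: block_mult SO_inverse mat_eq_block)
    moreover have "block (transpose C) 0 0 (transpose D) \<in> ?K"
      using CD by (simp add: space_BDI_def SO_inverse block_eq_iff)
    ultimately show ?thesis by blast
  qed
qed

lemma symmetric_pair_DIII: "symmetric_pair (space_DIII :: (('n::finite + 'n) + ('n + 'n)) cmat sym_space)"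
proof (rule symmetric_pair.intro)
  let ?K = "isot space_DIII :: (('n + 'n) + ('n + 'n)) cmat set"
  fix A B :: "(('n::finite + 'n) + ('n + 'n)) cmat"
  have JJ: "(- J) ** J = (mat 1 :: (('n + 'n) + ('n + 'n)) cmat)" by simp
  show "linear (invol space_DIII :: (('n + 'n) + ('n + 'n)) cmat \<Rightarrow> _)"
    "invol space_DIII (A ** B) = invol space_DIII A ** invol space_DIII B"
    "invol space_DIII (mat 1) = (mat 1 :: (('n + 'n) + ('n + 'n)) cmat)"
    using conj_involution[OF JJ] by (simp_all add: space_DIII_def)
  show "A \<in> grp space_DIII \<Longrightarrow> B \<in> grp space_DIII \<Longrightarrow> A ** B \<in> grp space_DIII"
    by (simp add: space_DIII_def SO_mult)
  show "mat 1 \<in> ?K" by (simp add: space_DIII_def)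
  show "A ** B \<in> ?K" if "A \<in> ?K" "B \<in> ?K"
  proof -
    have "A ** B ** J = A ** (B ** J)" by (simp add: matrix_mul_assoc)
    also have "\<dots> = (A ** J) ** B" using that(2) by (simp add: space_DIII_def matrix_mul_assoc)
    also have "\<dots> = J ** (A ** B)" using that(1) by (simp add: space_DIII_def matrix_mul_assoc)
    finally show ?thesis using that by (simp add: space_DIII_def SO_mult)
  qed
  show "invol space_DIII A = A" if "A \<in> ?K"
    using that conj_fixed_iff[OF JJ, of A A] by (simp add: space_DIII_def)
  show "\<exists>B\<in>?K. A ** B = mat 1" if "A \<in> ?K"
  proof (rule bexI)
    have A: "A \<in> SO" "J ** A = A ** J" using that by (auto simp: space_DIII_def)
    show inv: "A ** transpose A = mat 1" using A by (simp add: SO_inverse)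
    have "J ** transpose A = transpose A ** J"
      using A(2) inv matrix_left_right_inverse[THEN iffD1, OF inv] by (rule commute_inverse)
    then show "transpose A \<in> ?K" using A by (simp add: space_DIII_def SO_inverse)
  qed
qed

lemma symmetric_pair_CII: "symmetric_pair (space_CII :: (('n::finite + 'n) + ('n + 'n)) cmat sym_space)"
proof (rule symmetric_pair.intro)
  let ?K = "isot space_CII :: (('n + 'n) + ('n + 'n)) cmat set"
  fix A B :: "(('n::finite + 'n) + ('n + 'n)) cmat"
  have DD: "diag_CII ** diag_CII = (mat 1 :: (('n + 'n) + ('n + 'n)) cmat)"
    by (simp add: diag_CII_def block_mult mat_eq_block[where 'p = "'n + 'n" and 'q = "'n + 'n"])
  have inv: "matrix_inv diag_CII = (diag_CII :: (('n + 'n) + ('n + 'n)) cmat)"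
    using DD by (rule matrix_inv_eqI)
  show "linear (invol space_CII :: (('n + 'n) + ('n + 'n)) cmat \<Rightarrow> _)"
    "invol space_CII (A ** B) = invol space_CII A ** invol space_CII B"
    "invol space_CII (mat 1) = (mat 1 :: (('n + 'n) + ('n + 'n)) cmat)"
    using conj_involution[OF DD] by (simp_all add: space_CII_def inv)
  show "A \<in> grp space_CII \<Longrightarrow> B \<in> grp space_CII \<Longrightarrow> A ** B \<in> grp space_CII"
    by (simp add: space_CII_def Sp_mult)
  show "mat 1 \<in> ?K" by (simp add: space_CII_def)
  show "A ** B \<in> ?K" if "A \<in> ?K" "B \<in> ?K"
  proof -
    have "A ** B ** diag_CII = A ** (B ** diag_CII)" by (simp add: matrix_mul_assoc)
    also have "\<dots> = (A ** diag_CII) ** B" using that(2) by (simp add: space_CII_def matrix_mul_assoc)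
    also have "\<dots> = diag_CII ** (A ** B)" using that(1) by (simp add: space_CII_def matrix_mul_assoc)
    finally show ?thesis using that by (simp add: space_CII_def Sp_mult)
  qed
  show "invol space_CII A = A" if "A \<in> ?K"
    using that conj_fixed_iff[OF DD, of A A] by (simp add: space_CII_def inv)
  show "\<exists>B\<in>?K. A ** B = mat 1" if "A \<in> ?K"
  proof (rule bexI)
    have A: "A \<in> Sp" "diag_CII ** A = A ** diag_CII" using that by (auto simp: space_CII_def)
    show inv: "A ** transpose (cnj_mat A) = mat 1" using A by (simp add: Sp_iff U_inverse)
    have "diag_CII ** transpose (cnj_mat A) = transpose (cnj_mat A) ** diag_CII"
      using A(2) inv matrix_left_right_inverse[THEN iffD1, OF inv] by (rule commute_inverse)
    then show "transpose (cnj_mat A) \<in> ?K" using A by (simp add: space_CII_def Sp_inverse)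
  qed
qed

lemma symmetric_pair_CI: "symmetric_pair (space_CI :: ('n::finite + 'n) cmat sym_space)"
proof (rule symmetric_pair.intro)
  let ?K = "isot space_CI :: ('n + 'n) cmat set"
  fix A B :: "('n::finite + 'n) cmat"
  show "linear (invol space_CI :: ('n + 'n) cmat \<Rightarrow> _)"
    "invol space_CI (A ** B) = invol space_CI A ** invol space_CI B"
    "invol space_CI (mat 1) = (mat 1 :: ('n + 'n) cmat)"
    by (simp_all add: space_CI_def linear_cnj_mat cnj_mat_mult)
  show "A \<in> grp space_CI \<Longrightarrow> B \<in> grp space_CI \<Longrightarrow> A ** B \<in> grp space_CI"
    by (simp add: space_CI_def Sp_mult)
  show "mat 1 \<in> ?K" by (simp add: space_CI_def)
  show "A ** B \<in> ?K" if "A \<in> ?K" "B \<in> ?K"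
    using that by (simp add: space_CI_def Sp_mult SO_mult)
  show "invol space_CI A = A" if "A \<in> ?K"
    using that by (simp add: space_CI_def SO_iff)
  show "\<exists>B\<in>?K. A ** B = mat 1" if "A \<in> ?K"
    using that Sp_inverse[of A] SO_inverse[of A]
    by (intro bexI[of _ "transpose A"]) (simp_all add: space_CI_def SO_iff)
qed

lemma symmetric_pair_AI: "symmetric_pair (space_AI :: ('m::finite) cmat sym_space)"
proof (rule symmetric_pair.intro)
  let ?K = "isot space_AI :: 'm cmat set"
  fix A B :: "('m::finite) cmat"
  show "linear (invol space_AI :: 'm cmat \<Rightarrow> _)"
    "invol space_AI (A ** B) = invol space_AI A ** invol space_AI B"
    "invol space_AI (mat 1) = (mat 1 :: 'm cmat)"
    by (simp_all add: space_AI_def linear_cnj_mat cnj_mat_mult)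
  show "A \<in> grp space_AI \<Longrightarrow> B \<in> grp space_AI \<Longrightarrow> A ** B \<in> grp space_AI"
    by (simp add: space_AI_def SU_mult)
  show "mat 1 \<in> ?K" by (simp add: space_AI_def)
  show "A ** B \<in> ?K" if "A \<in> ?K" "B \<in> ?K"
    using that by (simp add: space_AI_def SO_mult)
  show "invol space_AI A = A" if "A \<in> ?K"
    using that by (simp add: space_AI_def SO_iff)
  show "\<exists>B\<in>?K. A ** B = mat 1" if "A \<in> ?K"
    using that SO_inverse[of A] by (intro bexI[of _ "transpose A"]) (simp_all add: space_AI_def)
qed

lemma symmetric_pair_AII: "symmetric_pair (space_AII :: ('n::finite + 'n) cmat sym_space)"
proof (rule symmetric_pair.intro)
  let ?K = "isot space_AII :: ('n + 'n) cmat set"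
  fix A B :: "('n::finite + 'n) cmat"
  have JJ: "(- J) ** J = (mat 1 :: ('n + 'n) cmat)" by simp
  show "linear (invol space_AII :: ('n + 'n) cmat \<Rightarrow> _)"
    using linear_compose[OF linear_cnj_mat conj_involution(1)[OF JJ]] by (simp add: space_AII_def o_def)
  show "invol space_AII (A ** B) = invol space_AII A ** invol space_AII B"
    "invol space_AII (mat 1) = (mat 1 :: ('n + 'n) cmat)"
    using conj_involution(2,3)[OF JJ] by (simp_all add: space_AII_def cnj_mat_mult)
  show "A \<in> grp space_AII \<Longrightarrow> B \<in> grp space_AII \<Longrightarrow> A ** B \<in> grp space_AII"
    by (simp add: space_AII_def SU_mult)
  show "mat 1 \<in> ?K" by (simp add: space_AII_def)
  show "A ** B \<in> ?K" if "A \<in> ?K" "B \<in> ?K"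
    using that by (simp add: space_AII_def Sp_mult)
  show "invol space_AII A = A" if "A \<in> ?K"
  proof -
    have "J ** A = cnj_mat A ** J" using that by (simp add: space_AII_def Sp_iff)
    then have "cnj_mat (J ** A) = cnj_mat (cnj_mat A ** J)" by simp
    then show ?thesis
      using conj_fixed_iff[OF JJ, of "cnj_mat A" A] by (simp add: space_AII_def cnj_mat_mult)
  qed
  show "\<exists>B\<in>?K. A ** B = mat 1" if "A \<in> ?K"
    using that Sp_inverse[of A]
    by (intro isot_inverse_U) (simp_all add: space_AII_def Sp_iff)
qed

lemma J_neq_0 [simp]: "J \<noteq> 0"
proof
  assume "J = (0 :: ('n::finite + 'n) cmat)"
  then have "J ** J = (0 :: ('n + 'n) cmat)" by simp
  then show False by simp
qed

lemma commute_scaleR_mexp: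
  fixes A X :: "('m::finite) cmat"
  assumes "A ** X = X ** A"
  shows "A ** mexp (t *\<^sub>R X) = mexp (t *\<^sub>R X) ** A"
  by (rule mexp_commute) (simp add: assms)

lemma mexp_scaleR_in_SO: "cnj_mat X = X \<Longrightarrow> transpose X = - X \<Longrightarrow> mexp (t *\<^sub>R X) \<in> SO"
  by (rule mexp_in_SO) (simp_all add: transpose_scalar)

lemma mexp_scaleR_in_Sp:
  assumes "transpose (cnj_mat X) = - X" "transpose X ** J + J ** X = 0"
  shows "mexp (t *\<^sub>R X) \<in> Sp"
proof (rule mexp_in_Sp)
  have "t *\<^sub>R (transpose X ** J + J ** X) = 0" using assms by simp
  then show "transpose (t *\<^sub>R X) ** J + J ** (t *\<^sub>R X) = 0"
    by (simp add: transpose_scalar scaleR_add_right)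
qed (simp add: assms transpose_scalar)

lemma mexp_J_in_Sp: "mexp (t *\<^sub>R J) \<in> Sp"
  by (rule mexp_scaleR_in_Sp) simp_all

lemma mexp_J_in_SO: "mexp (t *\<^sub>R J) \<in> SO"
  by (rule mexp_scaleR_in_SO) simp_all

text \<open>\<open>- 1\<close> is the value of \<open>mexp (t *\<^sub>R J)\<close> at \<open>t = pi\<close>.\<close>

lemma neg_one_in_SO: "mat (- 1) \<in> (SO :: ('n::finite + 'n) cmat set)"
proof -
  have "((1 / 2) *\<^sub>R J) ** ((1 / 2) *\<^sub>R J) = (mat (- 1 / 4) :: ('n + 'n) cmat)" by simp
  from mexp_half_imaginary[OF this, of "2 * pi"]
  have "mexp (pi *\<^sub>R (J :: ('n + 'n) cmat)) = mat (- 1)" by simp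
  then show ?thesis using mexp_J_in_SO by metis
qed

lemma neg_one_in_U: "mat (- 1) \<in> U"
  by (simp add: U_iff)

lemma neg_one_in_Sp: "mat (- 1) \<in> Sp"
  by (simp add: Sp_iff neg_one_in_U mat_mult_commute)

lemma (in symmetric_pair) spindle_half_imaginary:
  assumes "\<xi> ** \<xi> = mat (- 1 / 4)"
    and "Y ** \<xi> = - (\<xi> ** Y)" and "Y \<noteq> 0"
    and "\<And>t::real. mexp (t *\<^sub>R \<xi>) \<in> grp S" "invol S \<xi> = - \<xi>"
    and "\<And>t::real. mexp (t *\<^sub>R Y) \<in> grp S" "\<And>t::real. mexp (t *\<^sub>R Y) \<in> isot S"
    and "\<And>A. A \<in> isot S \<Longrightarrow> (- (2 *\<^sub>R \<xi>)) ** A ** (2 *\<^sub>R \<xi>) \<in> isot S"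
  shows "extrinsically_symmetric_type S \<xi> \<and>
    spindle_number S \<xi> = (if mat (- 1) \<in> isot S then 2 else 4)"
proof -
  interpret spindle_data S \<xi> Y "if mat (- 1) \<in> isot S then 2 else 4"
    by (rule spindle_data_half_imaginary) (fact assms)+
  show ?thesis using extrinsically_symmetric spindle_number_eq by blast
qed

lemma mexp_half_turn:
  fixes \<xi> :: "('m::finite) cmat"
  assumes "\<xi> ** \<xi> = mat (- 1 / 4)"
  shows "mexp (pi *\<^sub>R \<xi>) = 2 *\<^sub>R \<xi>" "mexp ((- pi) *\<^sub>R \<xi>) = - (2 *\<^sub>R \<xi>)"
  using mexp_half_imaginary[OF assms, of pi] mexp_half_imaginary[OF assms, of "- pi"] by simp_all

text \<open>Conjugation by \<open>2 \<xi>\<close> preserves the commutant of \<open>P\<close>: this is the half turn in the types whose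
  isotropy group is such a commutant.\<close>

lemma anticommute_conj_commute:
  fixes P A \<xi> :: "('m::finite) cmat"
  assumes "P ** \<xi> = - (\<xi> ** P)" "P ** A = A ** P"
  shows "P ** (\<xi> ** A ** \<xi>) = \<xi> ** A ** \<xi> ** P"
proof -
  have "P ** (\<xi> ** A ** \<xi>) = (P ** \<xi>) ** A ** \<xi>" by (simp add: matrix_mul_assoc)
  also have "\<dots> = - (\<xi> ** (P ** A) ** \<xi>)" by (simp add: assms(1) matrix_mul_assoc)
  also have "\<dots> = - (\<xi> ** A ** (P ** \<xi>))" by (simp add: assms(2) matrix_mul_assoc)
  also have "\<dots> = \<xi> ** A ** \<xi> ** P" by (simp add: assms(1) matrix_mul_assoc)
  finally show ?thesis .
qed

text \<open>\<open>Y = J\<close> is real, commutes with the symplectic form and anticommutes with \<open>\<xi>\<close>.\<close>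

lemma spindle_CI:
  fixes \<xi> :: "('n::finite + 'n) cmat"
  defines "\<xi> \<equiv> xi_CI"
  shows "extrinsically_symmetric_type space_CI \<xi> \<and> spindle_number space_CI \<xi> = 2"
proof -
  let ?S = "space_CI :: ('n + 'n) cmat sym_space"
  interpret symmetric_pair ?S by (rule symmetric_pair_CI)
  have sq: "\<xi> ** \<xi> = mat (- 1 / 4)"
    by (simp add: \<xi>_def xi_CI_def block_mult mat_eq_block)
  have cnj: "cnj_mat \<xi> = - \<xi>" "transpose \<xi> = \<xi>"
    by (simp_all add: \<xi>_def xi_CI_def block_simps)
  have anti: "J ** \<xi> = - (\<xi> ** J)"
    by (simp add: \<xi>_def xi_CI_def J_def block_mult block_simps)
  have xi_Sp: "mexp (t *\<^sub>R \<xi>) \<in> Sp" for t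
    by (rule mexp_scaleR_in_Sp) (simp_all add: cnj anti)
  have "extrinsically_symmetric_type space_CI \<xi> \<and>
    spindle_number space_CI \<xi> = (if mat (- 1) \<in> isot ?S then 2 else 4)"
  proof (rule spindle_half_imaginary[OF sq anti J_neq_0])
    fix A :: "('n + 'n) cmat" assume "A \<in> isot space_CI"
    then have A: "A \<in> Sp" "A \<in> SU" "cnj_mat A = A" by (simp_all add: space_CI_def SO_iff)
    let ?B = "(- (2 *\<^sub>R \<xi>)) ** A ** (2 *\<^sub>R \<xi>)"
    have "?B \<in> Sp"
      using Sp_mult[OF Sp_mult[OF xi_Sp[of "- pi"] A(1)] xi_Sp[of pi]] unfolding mexp_half_turn[OF sq] .
    moreover have "cnj_mat ?B = ?B" by (simp add: cnj_mat_mult cnj A)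
    moreover have "det ?B = 1"
    proof -
      have "det ?B = det (- (2 *\<^sub>R \<xi>) ** (2 *\<^sub>R \<xi>)) * det A"
        by (simp only: det_mul mult_ac)
      then show ?thesis using A(2) by (simp add: sq SU_def)
    qed
    ultimately show "?B \<in> isot space_CI" by (simp add: space_CI_def SO_iff SU_def Sp_iff)
  qed (simp_all add: space_CI_def xi_Sp mexp_J_in_Sp mexp_J_in_SO cnj)
  then show ?thesis by (simp add: space_CI_def neg_one_in_SO neg_one_in_Sp)
qed

text \<open>\<open>Y = J\<close> commutes with itself, hence lies in the Lie algebra of the isotropy group, and
  anticommutes with \<open>\<xi>\<close>.\<close>

lemma spindle_DIII:
  fixes \<xi> :: "(('n::finite + 'n) + ('n + 'n)) cmat"
  defines "\<xi> \<equiv> xi_DIII"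
  shows "extrinsically_symmetric_type space_DIII \<xi> \<and> spindle_number space_DIII \<xi> = 2"
proof -
  let ?S = "space_DIII :: (('n + 'n) + ('n + 'n)) cmat sym_space"
  interpret symmetric_pair ?S
    by (rule symmetric_pair_DIII)
  have sq: "\<xi> ** \<xi> = mat (- 1 / 4)"
    by (simp add: \<xi>_def xi_DIII_def block_mult block_simps mat_eq_block[where 'p = "'n + 'n" and 'q = "'n + 'n"])
  have cnj: "cnj_mat \<xi> = \<xi>" "transpose \<xi> = - \<xi>"
    by (simp_all add: \<xi>_def xi_DIII_def block_simps transpose_scalar)
  have anti: "J ** \<xi> = - (\<xi> ** J)"
    by (simp add: \<xi>_def xi_DIII_def J_def[where 'n = "'n + 'n"] block_mult block_simps)
  have inv: "J ** \<xi> ** J = \<xi>"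
    by (simp add: anti flip: matrix_mul_assoc)
  have xi_SO: "mexp (t *\<^sub>R \<xi>) \<in> SO" for t
    by (rule mexp_scaleR_in_SO) (simp_all add: cnj)
  have "extrinsically_symmetric_type space_DIII \<xi> \<and>
    spindle_number space_DIII \<xi> = (if mat (- 1) \<in> isot ?S then 2 else 4)"
  proof (rule spindle_half_imaginary[OF sq anti J_neq_0])
    fix A :: "(('n + 'n) + ('n + 'n)) cmat" assume "A \<in> isot space_DIII"
    then have A: "A \<in> SO" "J ** A = A ** J" by (simp_all add: space_DIII_def)
    let ?B = "(- (2 *\<^sub>R \<xi>)) ** A ** (2 *\<^sub>R \<xi>)"
    have "?B \<in> SO"
      using SO_mult[OF SO_mult[OF xi_SO[of "- pi"] A(1)] xi_SO[of pi]] unfolding mexp_half_turn[OF sq] .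
    moreover have "?B ** J = J ** ?B"
      using anticommute_conj_commute[OF anti A(2)] by simp
    ultimately show "?B \<in> isot space_DIII" by (simp add: space_DIII_def)
  qed (simp_all add: space_DIII_def xi_SO mexp_J_in_SO inv mexp_commute)
  then show ?thesis by (simp add: space_DIII_def neg_one_in_SO mat_mult_commute)
qed

text \<open>\<open>Y = J\<close> commutes with \<open>diag_CII\<close> and anticommutes with \<open>\<xi>\<close>.\<close>

lemma spindle_CII:
  fixes \<xi> :: "(('n::finite + 'n) + ('n + 'n)) cmat"
  defines "\<xi> \<equiv> xi_CII"
  shows "extrinsically_symmetric_type space_CII \<xi> \<and> spindle_number space_CII \<xi> = 2"
proof -
  let ?S = "space_CII :: (('n + 'n) + ('n + 'n)) cmat sym_space"
  interpret symmetric_pair ?S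
    by (rule symmetric_pair_CII)
  let ?\<eta> = "xi_AIII :: ('n + 'n) cmat" and ?D = "diag_CII :: (('n + 'n) + ('n + 'n)) cmat"
  have eta: "?\<eta> ** ?\<eta> = mat (- 1 / 4)" "cnj_mat ?\<eta> = - ?\<eta>" "transpose ?\<eta> = ?\<eta>"
    "diag_sign ** ?\<eta> = - (?\<eta> ** diag_sign)"
    by (simp_all add: xi_AIII_def block_mult mat_eq_block cnj_mat_block block_simps diag_sign_def)
  have sq: "\<xi> ** \<xi> = mat (- 1 / 4)"
    by (simp add: \<xi>_def xi_CII_def block_mult block_simps eta mat_eq_block[where 'p = "'n + 'n" and 'q = "'n + 'n"])
  have cnj: "cnj_mat \<xi> = - \<xi>" "transpose \<xi> = \<xi>"
    by (simp_all add: \<xi>_def xi_CII_def block_simps cnj_mat_block eta)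
  have anti: "J ** \<xi> = - (\<xi> ** J)"
    by (simp add: \<xi>_def xi_CII_def J_def[where 'n = "'n + 'n"] block_mult block_simps)
  have D_anti: "?D ** \<xi> = - (\<xi> ** ?D)"
    by (simp add: \<xi>_def xi_CII_def diag_CII_def block_mult block_simps eta)
  have DD: "?D ** ?D = mat 1"
    by (simp add: diag_CII_def block_mult mat_eq_block[where 'p = "'n + 'n" and 'q = "'n + 'n"])
  have D_J: "?D ** J = J ** ?D"
    by (simp add: diag_CII_def J_def[where 'n = "'n + 'n"] block_mult)
  have inv: "?D ** \<xi> ** matrix_inv ?D = - \<xi>"
    using matrix_inv_eqI[OF DD] by (simp add: D_anti DD flip: matrix_mul_assoc)
  have xi_Sp: "mexp (t *\<^sub>R \<xi>) \<in> Sp" for t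
    by (rule mexp_scaleR_in_Sp) (simp_all add: cnj anti)
  have "extrinsically_symmetric_type space_CII \<xi> \<and>
    spindle_number space_CII \<xi> = (if mat (- 1) \<in> isot ?S then 2 else 4)"
  proof (rule spindle_half_imaginary[OF sq anti J_neq_0])
    fix A :: "(('n + 'n) + ('n + 'n)) cmat" assume "A \<in> isot space_CII"
    then have A: "A \<in> Sp" "?D ** A = A ** ?D" by (simp_all add: space_CII_def)
    let ?B = "(- (2 *\<^sub>R \<xi>)) ** A ** (2 *\<^sub>R \<xi>)"
    have "?B \<in> Sp"
      using Sp_mult[OF Sp_mult[OF xi_Sp[of "- pi"] A(1)] xi_Sp[of pi]] unfolding mexp_half_turn[OF sq] .
    moreover have "?B ** ?D = ?D ** ?B"
      using anticommute_conj_commute[OF D_anti A(2)] by simp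
    ultimately show "?B \<in> isot space_CII" by (simp add: space_CII_def)
  qed (simp_all add: space_CII_def xi_Sp mexp_J_in_Sp inv commute_scaleR_mexp[OF D_J])
  then show ?thesis by (simp add: space_CII_def neg_one_in_Sp mat_mult_commute)
qed

text \<open>\<open>Y = \<i> * diag_sign\<close> anticommutes with \<open>\<xi>\<close>, and, up to a factor, each of the two is the witness of
  \<open>mexp_in_SU\<close> for the other. The half turn exchanges the two blocks.\<close>

lemma spindle_AIII:
  fixes \<xi> :: "('n::finite + 'n) cmat"
  defines "\<xi> \<equiv> xi_AIII"
  shows "extrinsically_symmetric_type space_AIII \<xi> \<and> spindle_number space_AIII \<xi> = 2"
proof -
  let ?S = "space_AIII :: ('n + 'n) cmat sym_space"
  interpret symmetric_pair ?S by (rule symmetric_pair_AIII)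
  define Y :: "('n + 'n) cmat" where "Y = block (mat \<i>) 0 0 (mat (- \<i>))"
  have sq: "\<xi> ** \<xi> = mat (- 1 / 4)" "Y ** Y = mat (- 1)"
    and adj: "transpose (cnj_mat \<xi>) = - \<xi>" "transpose (cnj_mat Y) = - Y"
    and anti: "Y ** \<xi> = - (\<xi> ** Y)" "diag_sign ** \<xi> = - (\<xi> ** diag_sign)"
    by (simp_all add: \<xi>_def Y_def xi_AIII_def diag_sign_def block_mult mat_eq_block block_simps
        cnj_mat_block)
  have Y_nz: "Y \<noteq> 0" using sq(2) by auto
  have xi_SU: "mexp (t *\<^sub>R \<xi>) \<in> SU" for t
    by (rule mexp_in_SU[where P = Y and Q = "- Y"]) (simp_all add: adj sq anti transpose_scalar)
  have Y_SU: "mexp (t *\<^sub>R Y) \<in> SU" for t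
    by (rule mexp_in_SU[where P = "2 *\<^sub>R \<xi>" and Q = "- (2 *\<^sub>R \<xi>)"])
      (simp_all add: adj sq anti transpose_scalar)
  have mat_U: "mexp (t *\<^sub>R (mat (c * \<i>) :: 'n cmat)) \<in> U" if "cnj c = c" for t :: real and c
    by (rule mexp_in_U) (simp add: that)
  have Y_isot: "mexp (t *\<^sub>R Y) \<in> isot space_AIII" for t
  proof -
    have "mexp (t *\<^sub>R Y) = block (mexp (t *\<^sub>R mat \<i>)) 0 0 (mexp (t *\<^sub>R mat (- \<i>)))"
      unfolding Y_def mexp_block[symmetric] by (simp add: block_simps)
    then show ?thesis
      using Y_SU[of t] mat_U[of 1 t] mat_U[of "- 1" t] by (auto simp: space_AIII_def)
  qed
  have "extrinsically_symmetric_type space_AIII \<xi> \<and>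
    spindle_number space_AIII \<xi> = (if mat (- 1) \<in> isot ?S then 2 else 4)"
  proof (rule spindle_half_imaginary[OF sq(1) anti(1) Y_nz])
    fix A :: "('n + 'n) cmat" assume "A \<in> isot space_AIII"
    then obtain a b where A: "A \<in> SU" "A = block a 0 0 b" "a \<in> U" "b \<in> U"
      by (auto simp: space_AIII_def)
    let ?B = "(- (2 *\<^sub>R \<xi>)) ** A ** (2 *\<^sub>R \<xi>)"
    have "?B \<in> SU"
      using SU_mult[OF SU_mult[OF xi_SU[of "- pi"] A(1)] xi_SU[of pi]] unfolding mexp_half_turn[OF sq(1)] .
    moreover have "?B = block b 0 0 a"
      by (simp add: A(2) \<xi>_def xi_AIII_def block_mult block_simps mat_mult_commute)
    ultimately show "?B \<in> isot space_AIII" using A(3,4) by (auto simp: space_AIII_def)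
  next
    show "invol space_AIII \<xi> = - \<xi>"
      using conj_fixed_iff[OF diag_sign_simps(1), of \<xi> "- \<xi>"] anti by (simp add: space_AIII_def)
  next
    show "mexp (t *\<^sub>R \<xi>) \<in> grp space_AIII" "mexp (t *\<^sub>R Y) \<in> grp space_AIII" for t :: real
      by (simp_all add: space_AIII_def xi_SU Y_SU)
  qed (rule Y_isot)
  moreover have "mat (- 1) \<in> (isot space_AIII :: ('n + 'n) cmat set)"
    using subsetD[OF SO_subset_SU neg_one_in_SO[where 'n = 'n]]
    by (simp add: space_AIII_def)
      (intro exI conjI, rule mat_eq_block, simp_all add: neg_one_in_U)
  ultimately show ?thesis by simp
qed

section \<open>Diagonal elements: types A I and A II\<close>

definition diag_mat :: "('m::finite \<Rightarrow> complex) \<Rightarrow> 'm cmat" where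
  "diag_mat d = (\<chi> i j. if i = j then d i else 0)"

lemma diag_mat_mult_nth:
  "(diag_mat d ** A) $ i $ j = d i * A $ i $ j" "(A ** diag_mat d) $ i $ j = A $ i $ j * d j"
  by (simp_all add: diag_mat_def matrix_matrix_mult_def mult_delta_left mult_delta_right)

lemma diag_mat_simps:
  "diag_mat d ** diag_mat e = diag_mat (\<lambda>i. d i * e i)" "cnj_mat (diag_mat d) = diag_mat (\<lambda>i. cnj (d i))"
  "transpose (diag_mat d) = diag_mat d" "diag_mat d = diag_mat e \<longleftrightarrow> (\<forall>i. d i = e i)"
  "diag_mat (\<lambda>i. 1) = mat 1" "- diag_mat d = diag_mat (\<lambda>i. - d i)"
  "det (diag_mat d) = (\<Prod>i\<in>UNIV. d i)"
proof -
  show "diag_mat d ** diag_mat e = diag_mat (\<lambda>i. d i * e i)"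
    unfolding vec_eq_iff diag_mat_mult_nth by (simp add: diag_mat_def)
  show "det (diag_mat d) = (\<Prod>i\<in>UNIV. d i)"
    by (subst det_diagonal) (simp_all add: diag_mat_def)
  show "diag_mat d = diag_mat e \<longleftrightarrow> (\<forall>i. d i = e i)"
  proof
    assume "diag_mat d = diag_mat e"
    then have "diag_mat d $ i $ i = diag_mat e $ i $ i" for i by simp
    then show "\<forall>i. d i = e i" by (simp add: diag_mat_def)
  qed (simp add: diag_mat_def vec_eq_iff)
qed (auto simp: diag_mat_def vec_eq_iff cnj_mat_def transpose_def mat_def)

lemma mexp_diag_mat: "mexp (t *\<^sub>R diag_mat d) = diag_mat (\<lambda>i. exp (of_real t * d i))"
proof -
  let ?F = "\<lambda>t::real. diag_mat (\<lambda>i. exp (of_real t * d i))"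
  have "(?F has_vector_derivative diag_mat d ** ?F t) (at t)" for t
  proof (rule has_vector_derivative_cmatI)
    fix i j
    have "((\<lambda>z. exp (z * d i)) has_field_derivative (exp (of_real t * d i) * d i)) (at (of_real t))"
      by (auto intro!: derivative_eq_intros)
    from has_vector_derivative_real_field[OF this]
    show "((\<lambda>t. ?F t $ i $ j) has_vector_derivative (diag_mat d ** ?F t) $ i $ j) (at t)"
      by (cases "i = j") (simp_all add: diag_mat_simps, simp_all add: diag_mat_def mult.commute)
  qed
  from mexp_ode_unique[of ?F, OF this, of t] show ?thesis by (simp add: diag_mat_simps)
qed

text \<open>The element \<open>\<xi>\<close> with eigenvalues \<open>\<i> * w i\<close>: \<open>ad \<xi>\<close> is diagonal with eigenvalues
  \<open>\<i> * (w i - w j)\<close>.\<close>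

locale integral_weights =
  fixes w :: "'m::finite \<Rightarrow> real"
  assumes sum_0: "sum w UNIV = 0" and diff: "\<And>i j. w i - w j \<in> {- 1, 0, 1}"
begin

abbreviation \<xi> :: "'m cmat" where "\<xi> \<equiv> diag_mat (\<lambda>i. \<i> * of_real (w i))"

lemma mexp_xi: "mexp (t *\<^sub>R \<xi>) = diag_mat (\<lambda>i. cis (t * w i))"
  by (simp add: mexp_diag_mat cis_conv_exp mult_ac)

lemma mexp_xi_in_SU: "mexp (t *\<^sub>R \<xi>) \<in> SU"
proof -
  have "(\<Prod>i\<in>UNIV. cis (t * w i)) = exp (\<i> * of_real (\<Sum>i\<in>UNIV. t * w i))"
    by (simp add: cis_conv_exp exp_sum sum_distrib_left)
  also have "(\<Sum>i\<in>UNIV. t * w i) = 0"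
    by (simp add: sum_distrib_left[symmetric] sum_0)
  finally show ?thesis
    by (simp add: mexp_xi SU_def U_iff diag_mat_simps cis_cnj cis_mult flip: cis_inverse)
qed

lemma bracket_xi_nth: "bracket \<xi> X $ i $ j = \<i> * of_real (w i - w j) * X $ i $ j"
  by (simp add: bracket_def diag_mat_mult_nth algebra_simps)

lemma bracket_xi_cubic: "bracket \<xi> (bracket \<xi> (bracket \<xi> X)) = - bracket \<xi> X"
proof -
  have "\<i> * of_real (w i - w j) * (\<i> * of_real (w i - w j) * (\<i> * of_real (w i - w j) * x))
      = - (\<i> * of_real (w i - w j) * x)" for i j x
    using diff[of i j] by (auto simp del: of_real_diff)
  then show ?thesis by (simp add: vec_eq_iff bracket_xi_nth del: of_real_diff)
qed

lemma bracket_xi_twice: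
  assumes "\<And>i j. Y $ i $ j \<noteq> 0 \<Longrightarrow> w i \<noteq> w j"
  shows "bracket \<xi> (bracket \<xi> Y) = - Y"
proof -
  have "\<i> * of_real (w i - w j) * (\<i> * of_real (w i - w j) * Y $ i $ j) = - Y $ i $ j" for i j
    using diff[of i j] assms[of i j] by (cases "Y $ i $ j = 0") (auto simp del: of_real_diff)
  then show ?thesis by (simp add: vec_eq_iff bracket_xi_nth del: of_real_diff)
qed

lemma cnj_xi: "cnj_mat \<xi> = - \<xi>" "cnj_mat (mexp (t *\<^sub>R \<xi>)) = mexp (- (t *\<^sub>R \<xi>))"
proof -
  show "cnj_mat \<xi> = - \<xi>" by (simp add: diag_mat_simps)
  then show "cnj_mat (mexp (t *\<^sub>R \<xi>)) = mexp (- (t *\<^sub>R \<xi>))" by (simp add: cnj_mat_mexp)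
qed

text \<open>Equivalently, \<open>mexp (2 * pi * \<xi>)\<close> is central: it is a scalar, because the weights differ by
  integers.\<close>

lemma half_turn_swap:
  "mexp (pi *\<^sub>R \<xi>) ** A ** mexp (- (pi *\<^sub>R \<xi>)) = mexp (- (pi *\<^sub>R \<xi>)) ** A ** mexp (pi *\<^sub>R \<xi>)"
proof -
  have minus: "mexp (- (pi *\<^sub>R \<xi>)) = diag_mat (\<lambda>i. cis (- (pi * w i)))"
    using mexp_xi[of "- pi"] by simp
  have swap: "cis (pi * w i) * x * cis (- (pi * w j)) = cis (- (pi * w i)) * x * cis (pi * w j)" for i j x
  proof -
    have "cis (pi * (w i - w j)) = cis (- (pi * (w i - w j)))"
      using diff[of i j] by (auto simp: cis.ctr complex_eq_iff)
    moreover have "cis (pi * w i) * cis (- (pi * w j)) = cis (pi * (w i - w j))"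
      "cis (- (pi * w i)) * cis (pi * w j) = cis (- (pi * (w i - w j)))"
      by (simp_all add: cis_mult algebra_simps)
    ultimately have "cis (pi * w i) * cis (- (pi * w j)) = cis (- (pi * w i)) * cis (pi * w j)"
      by simp
    then show ?thesis by (metis mult.assoc mult.commute)
  qed
  show ?thesis
    unfolding vec_eq_iff minus mexp_xi diag_mat_mult_nth by (intro allI swap)
qed

lemma mexp_xi_real_iff:
  "cnj_mat (mexp ((real j * pi) *\<^sub>R \<xi>)) = mexp ((real j * pi) *\<^sub>R \<xi>) \<longleftrightarrow> (\<forall>i. real j * w i \<in> \<int>)"
proof -
  have "cnj (cis (real j * pi * x)) = cis (real j * pi * x) \<longleftrightarrow> real j * x \<in> \<int>" for x
    using sin_times_pi_eq_0[of "real j * x"] by (simp add: complex_eq_iff mult_ac)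
  then show ?thesis by (simp add: mexp_xi diag_mat_simps)
qed

text \<open>An element of \<open>SU\<close> belongs to \<open>SO\<close> iff it is fixed by complex conjugation. It exchanges
  the two sides of \<open>half_turn_swap\<close> for real \<open>A\<close>, and it maps \<open>g t\<close> to \<open>g (- t)\<close>.\<close>

lemma spindle_AI:
  assumes "cnj_mat Y = Y" "transpose Y = - Y" "Y \<noteq> 0" "\<And>i j. Y $ i $ j \<noteq> 0 \<Longrightarrow> w i \<noteq> w j"
    and "m > 0" "\<And>j. 0 < j \<Longrightarrow> j \<le> m \<Longrightarrow> (\<forall>i. real j * w i \<in> \<int>) \<longleftrightarrow> j = m"
  shows "extrinsically_symmetric_type space_AI \<xi> \<and> spindle_number space_AI \<xi> = m"
proof -
  interpret symmetric_pair "space_AI :: 'm cmat sym_space" by (rule symmetric_pair_AI)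
  interpret spindle_data "space_AI :: 'm cmat sym_space" \<xi> Y m
  proof unfold_locales
    fix A :: "'m cmat" assume "A \<in> isot space_AI"
    then have A: "A \<in> SU" "cnj_mat A = A" by (simp_all add: space_AI_def SO_iff)
    let ?B = "mexp (- (pi *\<^sub>R \<xi>)) ** A ** mexp (pi *\<^sub>R \<xi>)"
    have "?B \<in> SU"
      using SU_mult[OF SU_mult[OF mexp_xi_in_SU[of "- pi"] A(1)] mexp_xi_in_SU[of pi]] by simp
    moreover have "cnj_mat ?B = ?B"
      using half_turn_swap[of A] cnj_xi(2)[of pi] cnj_xi(2)[of "- pi"] A by (simp add: cnj_mat_mult)
    ultimately show "?B \<in> isot space_AI" by (simp add: space_AI_def SO_iff)
  next
    show "mexp ((real j * pi) *\<^sub>R \<xi>) \<in> isot space_AI \<longleftrightarrow> j = m" if "0 < j" "j \<le> m" for j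
      using assms(6)[OF that] mexp_xi_real_iff[of j] mexp_xi_in_SU[of "real j * pi"]
      by (simp add: space_AI_def SO_iff)
  next
    show "mexp (t *\<^sub>R Y) \<in> isot space_AI" "mexp (t *\<^sub>R Y) \<in> grp space_AI"
      "mexp (t *\<^sub>R \<xi>) \<in> grp space_AI" for t :: real
      using mexp_scaleR_in_SO[OF assms(1,2), of t] SO_subset_SU mexp_xi_in_SU[of t]
      by (auto simp: space_AI_def)
    show "invol space_AI \<xi> = - \<xi>" using cnj_xi by (simp add: space_AI_def)
  qed (use assms bracket_xi_cubic bracket_xi_twice in auto)
  show ?thesis using extrinsically_symmetric spindle_number_eq by blast
qed

end

lemma (in integral_weights) doubled: "integral_weights (case_sum w w)"
proof
  show "sum (case_sum w w) UNIV = 0" by (simp add: sum_UNIV_sum_type sum_0)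
  show "case_sum w w i - case_sum w w j \<in> {- 1, 0, 1}" for i j
    using diff by (auto split: sum.split)
qed

text \<open>As \<open>block \<xi> 0 0 \<xi>\<close> commutes with \<open>J\<close>, its one-parameter group meets \<open>Sp\<close> exactly in its real
  elements, and the condition on \<open>m\<close> is the one of type A I.\<close>

lemma (in integral_weights) spindle_AII:
  assumes Y: "cnj_mat Y = Y" "transpose Y = - Y" "Y \<noteq> 0" "\<And>i j. Y $ i $ j \<noteq> 0 \<Longrightarrow> w i \<noteq> w j"
    and m: "m > 0" "\<And>j. 0 < j \<Longrightarrow> j \<le> m \<Longrightarrow> (\<forall>i. real j * w i \<in> \<int>) \<longleftrightarrow> j = m"
  shows "extrinsically_symmetric_type space_AII (block \<xi> 0 0 \<xi>) \<and>
    spindle_number space_AII (block \<xi> 0 0 \<xi>) = m"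
proof -
  interpret double: integral_weights "case_sum w w" by (rule doubled)
  let ?\<Xi> = "block \<xi> 0 0 \<xi>" and ?Y = "block Y 0 0 Y" and ?S = "space_AII :: ('m + 'm) cmat sym_space"
  have Xi: "double.\<xi> = ?\<Xi>"
    by (rule cmat_sum_type_eqI) (simp_all add: block_def diag_mat_def)
  note xi = double.mexp_xi_in_SU double.bracket_xi_cubic double.cnj_xi double.half_turn_swap
    double.mexp_xi_real_iff
  note xi = xi[unfolded Xi]
  have J: "J ** ?\<Xi> = ?\<Xi> ** J" "J ** ?Y = ?Y ** J"
    by (simp_all add: J_def block_mult)
  have YY: "cnj_mat ?Y = ?Y" "transpose ?Y = - ?Y" by (simp_all add: block_simps Y)
  interpret symmetric_pair ?S by (rule symmetric_pair_AII)
  interpret spindle_data ?S ?\<Xi> ?Y m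
  proof unfold_locales
    fix A :: "('m + 'm) cmat" assume "A \<in> isot space_AII"
    then have A: "A \<in> U" "J ** A = cnj_mat A ** J" by (simp_all add: space_AII_def Sp_iff)
    let ?g = "mexp (pi *\<^sub>R ?\<Xi>)" and ?h = "mexp (- (pi *\<^sub>R ?\<Xi>))"
    have gh: "J ** ?g = ?g ** J" "J ** ?h = ?h ** J"
      using commute_scaleR_mexp[OF J(1), of pi] commute_scaleR_mexp[OF J(1), of "- pi"] by simp_all
    have "?g \<in> U" "?h \<in> U" using SU_imp_U[OF xi(1)[of pi]] SU_imp_U[OF xi(1)[of "- pi"]] by simp_all
    then have "?h ** A ** ?g \<in> U" using A by (intro U_mult)
    moreover have "J ** (?h ** A ** ?g) = cnj_mat (?h ** A ** ?g) ** J"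
    proof -
      have "cnj_mat (?h ** A ** ?g) ** J = ?g ** cnj_mat A ** (?h ** J)"
        using xi(4)[of pi] xi(4)[of "- pi"] by (simp add: cnj_mat_mult matrix_mul_assoc)
      also have "\<dots> = ?g ** (cnj_mat A ** J) ** ?h"
        by (simp add: matrix_mul_assoc flip: gh)
      also have "\<dots> = (?g ** J) ** A ** ?h" by (simp add: matrix_mul_assoc flip: A(2))
      also have "\<dots> = J ** (?g ** A ** ?h)" by (simp add: matrix_mul_assoc flip: gh)
      finally show ?thesis by (simp add: xi(5))
    qed
    ultimately show "?h ** A ** ?g \<in> isot space_AII" by (simp add: space_AII_def Sp_iff)
  next
    show "mexp ((real j * pi) *\<^sub>R ?\<Xi>) \<in> isot space_AII \<longleftrightarrow> j = m" if j: "0 < j" "j \<le> m" for j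
    proof -
      let ?g = "mexp ((real j * pi) *\<^sub>R ?\<Xi>)"
      have "J ** ?g = ?g ** J" by (rule commute_scaleR_mexp[OF J(1)])
      moreover have "?g ** J = cnj_mat ?g ** J \<longleftrightarrow> ?g = cnj_mat ?g"
      proof
        assume "?g ** J = cnj_mat ?g ** J"
        then have "?g ** J ** J = cnj_mat ?g ** J ** J" by simp
        then show "?g = cnj_mat ?g" by (simp flip: matrix_mul_assoc)
      qed simp
      moreover have "?g = cnj_mat ?g \<longleftrightarrow> j = m"
        using xi(6)[of j] m(2)[OF j] by (auto simp: split_sum_all)
      ultimately show ?thesis using SU_imp_U[OF xi(1)] by (simp add: space_AII_def Sp_iff)
    qed
  next
    show "mexp (t *\<^sub>R ?Y) \<in> isot space_AII" "mexp (t *\<^sub>R ?Y) \<in> grp space_AII"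
      "mexp (t *\<^sub>R ?\<Xi>) \<in> grp space_AII" for t :: real
      using mexp_scaleR_in_SO[OF YY, of t] SO_subset_SU xi(1)[of t]
        mexp_scaleR_in_Sp[of ?Y t] YY J by (auto simp: space_AII_def)
    show "invol space_AII ?\<Xi> = - ?\<Xi>"
      using conj_fixed_iff[of "- J" J ?\<Xi> ?\<Xi>] J xi(3) by (simp add: space_AII_def)
    show "?Y \<noteq> 0" using Y(3) by (simp add: zero_eq_block block_eq_iff)
    have "w' i \<noteq> w' j" if "?Y $ i $ j \<noteq> 0" "w' = case_sum w w" for i j w'
      using that Y(4) by (cases i; cases j) (auto simp: block_def)
    then show "bracket ?\<Xi> (bracket ?\<Xi> ?Y) = - ?Y"
      unfolding Xi[symmetric] by (intro double.bracket_xi_twice) auto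
  qed (use m xi(2) in auto)
  show ?thesis using extrinsically_symmetric spindle_number_eq by blast
qed

lemma weights_AI:
  fixes w :: "'p::finite + 'q::finite \<Rightarrow> real"
  defines "w \<equiv> case_sum (\<lambda>_. - (real CARD('q) / real (CARD('p) + CARD('q))))
    (\<lambda>_. real CARD('p) / real (CARD('p) + CARD('q)))"
  shows "integral_weights w" "xi_AI = diag_mat (\<lambda>i. \<i> * of_real (w i))"
proof -
  show "integral_weights w"
  proof
    show "sum w UNIV = 0" by (simp add: w_def sum_UNIV_sum_type)
    have "real CARD('p) + real CARD('q) > 0"
      by (intro add_pos_pos) (simp_all add: card_gt_0_iff)
    then have "real CARD('p) / real (CARD('p) + CARD('q)) + real CARD('q) / real (CARD('p) + CARD('q)) = 1"
      by (simp add: add_divide_distrib[symmetric])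
    then show "w i - w j \<in> {- 1, 0, 1}" for i j
      by (cases i; cases j) (auto simp: w_def algebra_simps)
  qed
  show "xi_AI = diag_mat (\<lambda>i. \<i> * of_real (w i))"
    by (rule cmat_sum_type_eqI) (simp_all add: xi_AI_def block_def diag_mat_def w_def mat_def Let_def)
qed

lemma xi_BDI_1_simps:
  "cnj_mat (xi_BDI_1 i j) = xi_BDI_1 i j" "transpose (xi_BDI_1 i j) = - xi_BDI_1 i j" "xi_BDI_1 i j \<noteq> 0"
proof -
  show "cnj_mat (xi_BDI_1 i j) = xi_BDI_1 i j"
    by (rule cmat_sum_type_eqI) (simp_all add: xi_BDI_1_def block_def cnj_mat_def unit_entry_def transpose_def)
  show "transpose (xi_BDI_1 i j) = - xi_BDI_1 i j"
    by (simp add: xi_BDI_1_def block_simps)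
  have "xi_BDI_1 i j $ Inl i $ Inr j = 1" by (simp add: xi_BDI_1_def block_def unit_entry_def)
  then show "xi_BDI_1 i j \<noteq> 0" by auto
qed

lemma fraction_Ints_iff:
  assumes "0 < (s::nat)"
  shows "real n * (real p / real s) \<in> \<int> \<longleftrightarrow> s dvd n * p"
proof -
  have "real n * (real p / real s) \<in> \<int> \<longleftrightarrow> (of_int (int (n * p)) / of_int (int s) :: real) \<in> \<int>"
    by simp
  also have "\<dots> \<longleftrightarrow> int s = 0 \<or> int s dvd int (n * p)" by (rule of_int_div_of_int_in_Ints_iff)
  also have "\<dots> \<longleftrightarrow> s dvd n * p" using assms by (simp del: of_nat_mult)
  finally show ?thesis .
qed

text \<open>Both numbers are integral iff \<open>p + q\<close> divides \<open>gcd (n * p) (n * q) = n * gcd p q\<close>.\<close>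

lemma least_integral_multiple:
  fixes p q :: nat
  assumes "p > 0" "q > 0"
  defines "P \<equiv> \<lambda>n. 0 < n \<and> real n * (real p / real (p + q)) \<in> \<int> \<and> real n * (real q / real (p + q)) \<in> \<int>"
  shows "(LEAST n. P n) = (p + q) div gcd p q" "P (LEAST n. P n)"
    "\<And>j. 0 < j \<Longrightarrow> j \<le> (LEAST n. P n) \<Longrightarrow> P j \<longleftrightarrow> j = (LEAST n. P n)"
proof -
  let ?d = "gcd p q" and ?k = "(p + q) div gcd p q"
  have kd: "?k * ?d = p + q" by (rule dvd_div_mult_self) simp
  have P_iff: "P n \<longleftrightarrow> 0 < n \<and> p + q dvd n * p \<and> p + q dvd n * q" for n
    using assms unfolding P_def by (simp only: fraction_Ints_iff add_pos_pos)
  have P: "P ?k"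
  proof -
    have mult: "p + q dvd ?k * r" if "?d dvd r" for r
    proof -
      have "?k * r = ?k * (?d * (r div ?d))" using that by (simp only: dvd_mult_div_cancel)
      also have "\<dots> = (p + q) * (r div ?d)" by (simp only: mult.assoc[symmetric] kd)
      finally show ?thesis by (rule dvdI)
    qed
    have "0 < ?k * ?d" unfolding kd using assms by simp
    then have "0 < ?k" by (simp only: nat_0_less_mult_iff)
    then show ?thesis unfolding P_iff using mult by simp
  qed
  moreover have "?k \<le> n" if "P n" for n
  proof -
    have n: "0 < n" "p + q dvd n * p" "p + q dvd n * q" using that by (simp_all only: P_iff)
    then have "p + q dvd gcd (n * p) (n * q)" by (intro gcd_greatest)
    then have "?k * ?d dvd n * ?d" unfolding kd gcd_mult_distrib_nat[of n p q] .
    moreover have "?d \<noteq> 0" using assms(1) by simp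
    ultimately have "?k dvd n" by (rule dvd_times_right_cancel_iff[THEN iffD1, rotated])
    then show ?thesis using n(1) by (rule dvd_imp_le)
  qed
  ultimately show L: "(LEAST n. P n) = ?k" by (rule Least_equality)
  with P show PL: "P (LEAST n. P n)" by simp
  show "P j \<longleftrightarrow> j = (LEAST n. P n)" if "0 < j" "j \<le> (LEAST n. P n)" for j
    using PL that Least_le[of P j] by auto
qed

section \<open>Type BD I\<close>

lemma rect_mat_mult:
  fixes A :: "complex^'n^'m"
  shows "mat c ** A = (\<chi> i j. c * A $ i $ j)" "A ** mat c = (\<chi> i j. c * A $ i $ j)"
  by (simp_all add: vec_eq_iff mat_def matrix_matrix_mult_def mult_delta_left mult_delta_right)

definition matrix_unit :: "'m \<Rightarrow> 'm \<Rightarrow> ('m::finite) cmat" where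
  "matrix_unit a b = (\<chi> r c. if r = a \<and> c = b then 1 else 0)"

lemma matrix_unit_mult_nth:
  "(matrix_unit a b ** X) $ r $ c = (if r = a then X $ b $ c else 0)"
  "(X ** matrix_unit a b) $ r $ c = (if c = b then X $ r $ a else 0)"
  by (simp_all add: matrix_unit_def matrix_matrix_mult_def mult_delta_left mult_delta_right
      if_bool_eq_conj[symmetric])

lemma matrix_unit_mult: "matrix_unit a b ** matrix_unit c d = (if b = c then matrix_unit a d else 0)"
  unfolding vec_eq_iff matrix_unit_mult_nth by (auto simp: matrix_unit_def)

definition rotation_generator :: "'m \<Rightarrow> 'm \<Rightarrow> ('m::finite) cmat" where
  "rotation_generator a b = matrix_unit a b - matrix_unit b a"

lemma matrix_unit_real:
  "cnj_mat (matrix_unit a b) = matrix_unit a b" "transpose (matrix_unit a b) = matrix_unit b a"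
  by (simp_all add: vec_eq_iff matrix_unit_def cnj_mat_def transpose_def conj_commute)

lemma rotation_generator_real: "cnj_mat (rotation_generator a b) = rotation_generator a b"
  "transpose (rotation_generator a b) = - rotation_generator a b"
  by (simp_all add: rotation_generator_def matrix_unit_real)

lemma rotation_generator_nz:
  assumes "a \<noteq> b" shows "rotation_generator a b \<noteq> 0"
proof
  assume "rotation_generator a b = 0"
  then have "rotation_generator a b $ a $ b = 0" by simp
  then show False using assms by (simp add: rotation_generator_def matrix_unit_def)
qed

lemma rotation_generator_square:
  "a \<noteq> b \<Longrightarrow> rotation_generator a b ** rotation_generator a b = - matrix_unit a a - matrix_unit b b"
  by (simp add: rotation_generator_def cmat_distrib matrix_unit_mult)

lemma rotation_generator_cube:
  "a \<noteq> b \<Longrightarrow> rotation_generator a b ** (rotation_generator a b ** rotation_generator a b) = - rotation_generator a b"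
  by (simp add: rotation_generator_square) (simp add: rotation_generator_def cmat_distrib matrix_unit_mult)

lemma bracket_rotation_generator:
  assumes "a \<noteq> b" "b \<noteq> c" "a \<noteq> c"
  shows "bracket (rotation_generator a b) (bracket (rotation_generator a b) (rotation_generator b c)) = - rotation_generator b c"
  using assms assms[symmetric]
  by (simp add: bracket_def rotation_generator_def cmat_distrib matrix_unit_mult)

text \<open>On all matrices \<open>ad R\<close> also has the eigenvalues \<open>\<plusminus>2\<i>\<close>. For antisymmetric \<open>X\<close> they do not occur,
  because \<open>R ** X ** R\<close> is then a multiple of \<open>R\<close> and commutes with it.\<close>

lemma bracket_rotation_generator_cubic:
  assumes X: "transpose X = - X" and ab: "a \<noteq> b"
  defines "R \<equiv> rotation_generator a b"
  shows "bracket R (bracket R (bracket R X)) = - bracket R X"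
proof -
  have anti: "X $ c $ r = - X $ r $ c" for r c
    using arg_cong[OF X, of "\<lambda>M. M $ r $ c"] by (simp add: transpose_def)
  have diag: "X $ r $ r = 0" for r using anti[of r r] by simp
  have "R ** X ** R = mat (X $ b $ a) ** R"
    unfolding vec_eq_iff R_def rotation_generator_def mat_mult_nth cmat_distrib
    using ab diag anti[of a b] by (auto simp: matrix_unit_mult_nth) (auto simp: mat_def)
  then have comm: "R ** R ** X ** R = R ** X ** R ** R"
    by (metis mat_mult_commute matrix_mul_assoc)
  have cube: "R ** R ** R = - R" using rotation_generator_cube[OF ab] by (simp add: R_def matrix_mul_assoc)
  have cube': "A ** R ** R ** R = - (A ** R)" for A
    using cube by (simp flip: matrix_mul_assoc)
  have "bracket R (bracket R X) = R ** R ** X - 2 *\<^sub>R (R ** X ** R) + X ** R ** R"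
    by (simp add: bracket_def cmat_distrib matrix_mul_assoc scaleR_2)
  then have "bracket R (bracket R (bracket R X)) = R ** (R ** R ** X - 2 *\<^sub>R (R ** X ** R) + X ** R ** R)
      - (R ** R ** X - 2 *\<^sub>R (R ** X ** R) + X ** R ** R) ** R"
    by (simp only: bracket_def[of R "R ** R ** X - 2 *\<^sub>R (R ** X ** R) + X ** R ** R"])
  also have "\<dots> = - bracket R X"
    by (simp add: cmat_distrib matrix_mul_assoc cube cube' comm) (simp add: bracket_def scaleR_2)
  finally show ?thesis .
qed

lemma mexp_cubic:
  fixes X :: "('m::finite) cmat"
  assumes "X ** (X ** X) = - X"
  shows "mexp (t *\<^sub>R X) = mat 1 + sin t *\<^sub>R X + (1 - cos t) *\<^sub>R (X ** X)"
proof -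
  let ?F = "\<lambda>t. mat 1 + sin t *\<^sub>R X + (1 - cos t) *\<^sub>R (X ** X)"
  have "(?F has_vector_derivative X ** ?F t) (at t)" for t
  proof (rule has_vector_derivative_eq_rhs)
    show "(?F has_vector_derivative cos t *\<^sub>R X + sin t *\<^sub>R (X ** X)) (at t)"
      by (auto intro!: derivative_eq_intros)
  qed (simp add: cmat_distrib assms scaleR_diff_left)
  from mexp_ode_unique[of ?F, OF this, of t] show ?thesis by simp
qed

definition reflection :: "'m \<Rightarrow> ('m::finite) cmat" where
  "reflection a = diag_mat (\<lambda>r. if r = a then - 1 else 1)"

lemma reflection_simps: "reflection a ** reflection a = mat 1" "det (reflection a) = - 1"
  "cnj_mat (reflection a) = reflection a" "transpose (reflection a) = reflection a"
proof -
  show "reflection a ** reflection a = mat 1"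
    by (simp add: reflection_def diag_mat_simps flip: diag_mat_simps(5))
  show "det (reflection a) = - 1"
    by (simp add: reflection_def diag_mat_simps prod.delta)
qed (simp_all add: reflection_def diag_mat_simps)

lemma reflection_conj_SO:
  assumes "A \<in> SO" shows "reflection a ** A ** reflection a \<in> SO"
proof -
  let ?D = "reflection a"
  have A: "A \<in> U" "det A = 1" "cnj_mat A = A" using assms by (simp_all add: SO_iff SU_def)
  have D: "?D \<in> U" by (simp add: U_iff reflection_simps)
  have "det (?D ** A ** ?D) = 1" by (simp add: det_mul reflection_simps A)
  then show ?thesis
    using A D by (simp add: SO_iff SU_def U_mult cnj_mat_mult reflection_simps)
qed

text \<open>Since \<open>q \<ge> 2\<close>, the last \<open>q\<close> coordinates contain an index \<open>j'\<close> besides \<open>j\<close>, and the rotation in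
  the plane of \<open>j\<close> and \<open>j'\<close> serves as \<open>Y\<close>. Together with \<open>\<xi>\<close> it generates a copy of
  \<open>\<ss>\<oo>(3)\<close>. The half turn is a reflection in each block.\<close>

lemma spindle_BDI_1:
  fixes i :: "'p::finite" and j j' :: "'q::finite"
  assumes "j' \<noteq> j"
  shows "extrinsically_symmetric_type space_BDI (xi_BDI_1 i j) \<and> spindle_number space_BDI (xi_BDI_1 i j) = 2"
proof -
  let ?S = "space_BDI :: ('p + 'q) cmat sym_space"
  interpret symmetric_pair ?S by (rule symmetric_pair_BDI)
  let ?a = "Inl i :: 'p + 'q" and ?b = "Inr j :: 'p + 'q" and ?c = "Inr j' :: 'p + 'q"
  let ?\<xi> = "xi_BDI_1 i j" and ?Y = "rotation_generator ?b ?c"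
  let ?D = "block (reflection i) 0 0 (reflection j)"
  have xi: "?\<xi> = rotation_generator ?a ?b"
    by (rule cmat_sum_type_eqI)
      (simp_all add: xi_BDI_1_def rotation_generator_def matrix_unit_def block_def unit_entry_def transpose_def)
  have Y: "?Y = block 0 0 0 (rotation_generator j j')"
    by (rule cmat_sum_type_eqI) (simp_all add: rotation_generator_def matrix_unit_def block_def)
  have exp: "mexp (t *\<^sub>R ?\<xi>) = mat 1 + sin t *\<^sub>R ?\<xi> + (1 - cos t) *\<^sub>R (?\<xi> ** ?\<xi>)" for t
    by (rule mexp_cubic) (simp add: xi rotation_generator_cube)
  have D: "mat 1 + 2 *\<^sub>R (?\<xi> ** ?\<xi>) = ?D"
    by (rule cmat_sum_type_eqI)
      (simp_all add: xi rotation_generator_square matrix_unit_def block_def reflection_def diag_mat_def mat_def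
        scaleR_conv_of_real[where 'a = complex])
  have exp_pi: "mexp (pi *\<^sub>R ?\<xi>) = ?D" "mexp (- (pi *\<^sub>R ?\<xi>)) = ?D"
    using exp[of pi] exp[of "- pi"] D by simp_all
  interpret spindle_data ?S ?\<xi> ?Y 2
  proof unfold_locales
    show "mexp (t *\<^sub>R ?\<xi>) \<in> grp ?S" "mexp (t *\<^sub>R ?Y) \<in> grp ?S" for t :: real
      by (simp_all add: space_BDI_def xi mexp_scaleR_in_SO rotation_generator_real)
    have dd: "diag_sign ** diag_sign = (mat 1 :: ('p + 'q) cmat)" by simp
    have "diag_sign ** ?\<xi> = - ?\<xi> ** diag_sign"
      by (simp add: xi_BDI_1_def diag_sign_def block_simps block_mult rect_mat_mult)
        (simp add: block_eq_iff, simp add: vec_eq_iff)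
    then show "invol ?S ?\<xi> = - ?\<xi>"
      using conj_fixed_iff[OF dd, of ?\<xi> "- ?\<xi>"] by (simp add: space_BDI_def)
    show "bracket ?\<xi> (bracket ?\<xi> (bracket ?\<xi> X)) = - bracket ?\<xi> X" if "X \<in> lie_algebra (grp ?S)" for X
    proof -
      have "transpose X = - X"
        using that by (intro lie_algebra_SO_antisymmetric) (simp add: space_BDI_def)
      then show ?thesis unfolding xi by (rule bracket_rotation_generator_cubic) simp
    qed
    show "?Y \<noteq> 0" using assms by (intro rotation_generator_nz) simp
    show "bracket ?\<xi> (bracket ?\<xi> ?Y) = - ?Y"
      unfolding xi using assms by (intro bracket_rotation_generator) simp_all
    show "mexp (t *\<^sub>R ?Y) \<in> isot ?S" for t :: real
    proof -
      have "mexp (t *\<^sub>R ?Y) = block (mat 1) 0 0 (mexp (t *\<^sub>R rotation_generator j j'))"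
        unfolding Y mexp_0[symmetric] mexp_block[symmetric] by (simp add: block_simps)
      then show ?thesis
        by (simp add: space_BDI_def block_eq_iff mexp_scaleR_in_SO rotation_generator_real)
    qed
    show "mexp (- (pi *\<^sub>R ?\<xi>)) ** A ** mexp (pi *\<^sub>R ?\<xi>) \<in> isot ?S" if A: "A \<in> isot ?S" for A
    proof -
      obtain B C where "A = block B 0 0 C" "B \<in> SO" "C \<in> SO" using A by (auto simp: space_BDI_def)
      then show ?thesis
        by (simp add: exp_pi space_BDI_def block_mult block_eq_iff reflection_conj_SO)
    qed
    show "mexp ((real k * pi) *\<^sub>R ?\<xi>) \<in> isot ?S \<longleftrightarrow> k = 2" if "0 < k" "k \<le> 2" for k
    proof -
      have "reflection i \<notin> SO" by (simp add: SO_def reflection_simps)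
      then have "?D \<notin> isot ?S" by (simp add: space_BDI_def block_eq_iff)
      moreover have "k \<in> {1, 2}" using that by auto
      ultimately show ?thesis using exp_pi exp[of "2 * pi"] isot_one by auto
    qed
  qed simp
  show ?thesis using extrinsically_symmetric spindle_number_eq by blast
qed

lemma neg_one_in_SO_iff: "mat (- 1) \<in> (SO :: ('n::finite) cmat set) \<longleftrightarrow> even CARD('n)"
proof -
  have "mat (- 1) = (diag_mat (\<lambda>_. - 1) :: 'n cmat)" by (simp add: mat_def diag_mat_def)
  then have "det (mat (- 1) :: 'n cmat) = (- 1) ^ CARD('n)" by (simp add: diag_mat_simps)
  then show ?thesis
    by (auto simp: SO_iff SU_def neg_one_in_U minus_one_power_iff)
qed

text \<open>\<open>Y\<close> has the blocks \<open>R\<close> and \<open>- R\<close> for a real antisymmetric \<open>R\<close>; the opposite signs make it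
  anticommute with \<open>J\<close>. The blocks of \<open>- 1\<close> have determinant 1 iff \<open>n\<close> is even.\<close>

lemma spindle_BDI_2:
  fixes a b :: "'n::finite" and \<xi> :: "('n + 'n) cmat"
  assumes "a \<noteq> b"
  defines "\<xi> \<equiv> xi_BDI_2"
  shows "extrinsically_symmetric_type space_BDI \<xi> \<and>
    spindle_number space_BDI \<xi> = (if even CARD('n) then 2 else 4)"
proof -
  let ?S = "space_BDI :: ('n + 'n) cmat sym_space"
  interpret symmetric_pair ?S by (rule symmetric_pair_BDI)
  let ?R = "rotation_generator a b" let ?Y = "block ?R 0 0 (- ?R)"
  have sq: "\<xi> ** \<xi> = mat (- 1 / 4)" by (simp add: \<xi>_def xi_BDI_2_def)
  have real: "cnj_mat \<xi> = \<xi>" "transpose \<xi> = - \<xi>"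
    by (simp_all add: \<xi>_def xi_BDI_2_def transpose_scalar)
  have anti: "?Y ** \<xi> = - (\<xi> ** ?Y)"
    by (simp add: \<xi>_def xi_BDI_2_def J_def block_mult block_simps mat_mult_commute)
  have Y_nz: "?Y \<noteq> 0" using rotation_generator_nz[OF assms(1)] by (simp add: zero_eq_block block_eq_iff)
  have Y_real: "cnj_mat ?Y = ?Y" "transpose ?Y = - ?Y" by (simp_all add: block_simps rotation_generator_real)
  have "extrinsically_symmetric_type ?S \<xi> \<and>
    spindle_number ?S \<xi> = (if mat (- 1) \<in> isot ?S then 2 else 4)"
  proof (rule spindle_half_imaginary[OF sq anti Y_nz])
    show "mexp (t *\<^sub>R \<xi>) \<in> grp ?S" "mexp (t *\<^sub>R ?Y) \<in> grp ?S" for t :: real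
      using mexp_scaleR_in_SO[OF real] mexp_scaleR_in_SO[OF Y_real] by (simp_all add: space_BDI_def)
    have "diag_sign ** \<xi> = - \<xi> ** diag_sign"
      by (simp add: \<xi>_def xi_BDI_2_def J_def diag_sign_def block_mult block_simps)
    then show "invol ?S \<xi> = - \<xi>"
      using conj_fixed_iff[OF diag_sign_simps(1), of \<xi> "- \<xi>"] by (simp add: space_BDI_def)
    show "mexp (t *\<^sub>R ?Y) \<in> isot ?S" for t :: real
    proof -
      have "mexp (t *\<^sub>R ?Y) = block (mexp (t *\<^sub>R ?R)) 0 0 (mexp (t *\<^sub>R (- ?R)))"
        unfolding mexp_block[symmetric] by (simp add: block_simps)
      then show ?thesis
        using mexp_scaleR_in_SO[of ?R t] mexp_scaleR_in_SO[of "- ?R" t]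
        by (simp add: space_BDI_def block_eq_iff rotation_generator_real)
    qed
    show "- (2 *\<^sub>R \<xi>) ** A ** (2 *\<^sub>R \<xi>) \<in> isot ?S" if A: "A \<in> isot ?S" for A
    proof -
      obtain B C where "A = block B 0 0 C" "B \<in> SO" "C \<in> SO" using A by (auto simp: space_BDI_def)
      then show ?thesis
        by (simp add: space_BDI_def \<xi>_def xi_BDI_2_def J_def block_mult block_simps block_eq_iff)
    qed
  qed
  moreover have "mat (- 1) \<in> isot ?S \<longleftrightarrow> even CARD('n)"
    by (simp add: space_BDI_def mat_eq_block block_eq_iff neg_one_in_SO_iff)
  ultimately show ?thesis by simp
qed

lemma integral_multiple_weights_AI:
  fixes w :: "'p::finite + 'q::finite \<Rightarrow> real"
  defines "w \<equiv> case_sum (\<lambda>_. - (real CARD('q) / real (CARD('p) + CARD('q))))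
    (\<lambda>_. real CARD('p) / real (CARD('p) + CARD('q)))"
  shows "(\<forall>i. real n * w i \<in> \<int>) \<longleftrightarrow>
    real n * (real CARD('p) / real (CARD('p) + CARD('q))) \<in> \<int> \<and>
    real n * (real CARD('q) / real (CARD('p) + CARD('q))) \<in> \<int>"
  unfolding w_def split_sum_all by (auto simp: minus_in_Ints_iff)

theorem mainTheorem4:
  shows
  \<comment> \<open>A I\<close>
  "(let p = CARD('p::finite); q = CARD('q::finite); \<xi> = (xi_AI :: ('p + 'q) cmat) in
      p \<le> q \<longrightarrow>
        extrinsically_symmetric_type space_AI \<xi> \<and>
        spindle_number space_AI \<xi> =
          (LEAST n::nat. 0 < n \<and> real n * (real p / real (p + q)) \<in> \<int>
                               \<and> real n * (real q / real (p + q)) \<in> \<int>) \<and>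
        spindle_number space_AI \<xi> = (p + q) div gcd p q)
  \<and> \<comment> \<open>A II\<close>
   (let p = CARD('p); q = CARD('q); \<xi> = (xi_AII :: (('p + 'q) + ('p + 'q)) cmat) in
      p \<le> q \<longrightarrow>
        extrinsically_symmetric_type space_AII \<xi> \<and>
        spindle_number space_AII \<xi> =
          (LEAST n::nat. 0 < n \<and> real n * (real p / real (p + q)) \<in> \<int>
                               \<and> real n * (real q / real (p + q)) \<in> \<int>) \<and>
        spindle_number space_AII \<xi> = (p + q) div gcd p q)
  \<and> \<comment> \<open>A III\<close>
   (let \<xi> = (xi_AIII :: ('n::finite + 'n) cmat) in
      extrinsically_symmetric_type space_AIII \<xi> \<and> spindle_number space_AIII \<xi> = 2)
  \<and> \<comment> \<open>BD I, first case\<close>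
   (\<forall>(i::'p) (j::'q). let p = CARD('p); q = CARD('q); \<xi> = xi_BDI_1 i j in
      p \<le> q \<and> p + q \<ge> 3 \<and> (p, q) \<noteq> (2, 2) \<longrightarrow>
        extrinsically_symmetric_type space_BDI \<xi> \<and> spindle_number space_BDI \<xi> = 2)
  \<and> \<comment> \<open>BD I, second case\<close>
   (let n = CARD('n); \<xi> = (xi_BDI_2 :: ('n + 'n) cmat) in
      n \<ge> 3 \<longrightarrow>
        extrinsically_symmetric_type space_BDI \<xi> \<and>
        spindle_number space_BDI \<xi> = (if even n then 2 else 4))
  \<and> \<comment> \<open>D III\<close>
   (let \<xi> = (xi_DIII :: (('n + 'n) + ('n + 'n)) cmat) in
      extrinsically_symmetric_type space_DIII \<xi> \<and> spindle_number space_DIII \<xi> = 2)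
  \<and> \<comment> \<open>C I\<close>
   (let \<xi> = (xi_CI :: ('n + 'n) cmat) in
      extrinsically_symmetric_type space_CI \<xi> \<and> spindle_number space_CI \<xi> = 2)
  \<and> \<comment> \<open>C II\<close>
   (let \<xi> = (xi_CII :: (('n + 'n) + ('n + 'n)) cmat) in
      extrinsically_symmetric_type space_CII \<xi> \<and> spindle_number space_CII \<xi> = 2)"
proof -
  let ?p = "CARD('p)" and ?q = "CARD('q)"
  let ?w = "case_sum (\<lambda>_. - (real ?q / real (?p + ?q))) (\<lambda>_. real ?p / real (?p + ?q)) :: 'p + 'q \<Rightarrow> real"
  define m where "m = (LEAST n::nat. 0 < n \<and> real n * (real ?p / real (?p + ?q)) \<in> \<int>
                               \<and> real n * (real ?q / real (?p + ?q)) \<in> \<int>)"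
  interpret integral_weights ?w by (rule weights_AI)
  have pos: "?p > 0" "?q > 0" by (simp_all add: card_gt_0_iff)
  note least = least_integral_multiple[OF pos, folded m_def]
  have m_pos: "m > 0" using least(2) by blast
  have m_first: "(\<forall>i. real k * ?w i \<in> \<int>) \<longleftrightarrow> k = m" if "0 < k" "k \<le> m" for k
    unfolding integral_multiple_weights_AI using least(3)[OF that] that(1) by blast
  \<comment> \<open>Any entry will do for the position of the rotation that serves as \<open>Y\<close> in types A I and A II.\<close>
  fix a :: 'p and b :: 'q
  have Y_nth: "?w r \<noteq> ?w c" if "xi_BDI_1 a b $ r $ c \<noteq> 0" for r c
  proof -
    have "real ?p / real (?p + ?q) > 0" "real ?q / real (?p + ?q) > 0"
      using pos by (auto intro!: divide_pos_pos simp del: of_nat_add)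
    then have "- (real ?q / real (?p + ?q)) \<noteq> real ?p / real (?p + ?q)" by linarith
    with that show ?thesis by (cases r; cases c) (simp_all add: xi_BDI_1_def block_def)
  qed
  have AI: "extrinsically_symmetric_type space_AI (xi_AI :: ('p + 'q) cmat) \<and>
      spindle_number space_AI (xi_AI :: ('p + 'q) cmat) = m"
    unfolding weights_AI(2) by (rule spindle_AI[OF xi_BDI_1_simps Y_nth m_pos m_first])
  have AII: "extrinsically_symmetric_type space_AII (xi_AII :: (('p + 'q) + ('p + 'q)) cmat) \<and>
      spindle_number space_AII (xi_AII :: (('p + 'q) + ('p + 'q)) cmat) = m"
    unfolding xi_AII_def weights_AI(2) by (rule spindle_AII[OF xi_BDI_1_simps Y_nth m_pos m_first])
  have BDI_1: "extrinsically_symmetric_type space_BDI (xi_BDI_1 i j) \<and> spindle_number space_BDI (xi_BDI_1 i j) = 2"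
    if "?p \<le> ?q" "?p + ?q \<ge> 3" for i :: 'p and j :: 'q
  proof -
    have "(UNIV :: 'q set) \<noteq> {j}"
    proof
      assume "(UNIV :: 'q set) = {j}"
      from arg_cong[OF this, of card] have "?q = 1" by simp
      then show False using that by linarith
    qed
    then obtain j' where "j' \<noteq> j" by auto
    then show ?thesis by (rule spindle_BDI_1)
  qed
  have BDI_2: "extrinsically_symmetric_type space_BDI (xi_BDI_2 :: ('n + 'n) cmat) \<and>
      spindle_number space_BDI (xi_BDI_2 :: ('n + 'n) cmat) = (if even CARD('n) then 2 else 4)"
    if "CARD('n) \<ge> 3"
  proof -
    have "\<not> CARD('n) \<le> 1" using that by linarith
    then obtain x y :: 'n where "x \<noteq> y" using card_le_Suc0_iff_eq[of "UNIV :: 'n set"] by auto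
    then show ?thesis by (rule spindle_BDI_2)
  qed
  show ?thesis
    unfolding Let_def m_def[symmetric] least(1)[symmetric]
    using AI AII BDI_1 BDI_2 spindle_AIII spindle_DIII spindle_CI spindle_CII by (intro conjI allI impI) auto
qed

end
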